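(* Let $N\ge 1$ be an integer and $\mathbb{K}\in\{\mathbb{R},\mathbb{C}\}$. (a) Each connected, simply connected, $(N+1)$-step nilpotent Banach-Lie group over $\mathbb{K}$ has a faithful, unipotent, norm continuous representation on a suitable Banach space, with unipotence index at most $2^{N-1}N+1$. (b) Every $(N+1)$-step nilpotent Banach-Lie algebra over $\mathbb{K}$ has a faithful bounded representation by nilpotent operators on some Banach space, with nilpotence index at most $2^{N-1}N+1$.
   Context: A Banach-Lie algebra over $\mathbb{K}$ is a Banach space over $\mathbb{K}$ with a continuous Lie bracket. Put $\mathfrak{g}^{(1)}=\mathfrak{g}$ and $\mathfrak{g}^{(j)}=[\mathfrak{g},\mathfrak{g}^{(j-1)}]$ for $j\ge2$. In this paper's convention, $\mathfrak{g}$ is $(N+1)$-step nilpotent (nilpotency index $N+1$) if $\mathfrak{g}^{(N)}\neq\{0\}=\mathfrak{g}^{(N+1)}$. A connected, simply connected Banach-Lie group is $(N+1)$-step nilpotent if its Lie algebra is; such a group is identified with $(\mathfrak{g},\ast)$, where $\mathfrak{g}$ is its Lie algebra and $\ast$ is the multiplication given by the (finite) Baker-Campbell-Hausdorff formula. For a Banach space $X$ over $\mathbb{K}$, let $\mathcal{B}(X)$ be the algebra of bounded linear operators with the operator norm. A norm continuous representation of a group $G$ on $X$ is a group homomorphism $\pi$ from $G$ into the invertible elements of $\mathcal{B}(X)$ that is continuous with respect to the operator norm; it is faithful if injective, and unipotent with unipotence index at most $q$ if $(\pi(g)-\mathbf{1})^q=0$ for every $g\in G$. A bounded representation of $\mathfrak{g}$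 on $X$ is a bounded (continuous) linear Lie algebra homomorphism $\rho\colon\mathfrak{g}\to\mathcal{B}(X)$, with the commutator bracket on $\mathcal{B}(X)$; it is faithful if injective, and it is by nilpotent operators with nilpotence index at most $q$ if $\rho(x)^q=0$ for every $x\in\mathfrak{g}$. *)

theory Defs
  imports "HOL-Analysis.Analysis" "HOL-Algebra.Group" "HOL-Library.Function_Algebras"
begin

section \<open>Banach spaces over a scalar field, possibly carried by a subset of a type\<close>

text \<open>
  The scalar field is a type \<open>'k\<close>, to be instantiated with \<^typ>\<open>real\<close> or \<^typ>\<open>complex\<close>.
  Nonnegativity of the norm follows from the triangle inequality and homogeneity.
\<close>

definition banach_space_on ::
  "('k::real_normed_field \<Rightarrow> 'x::ab_group_add \<Rightarrow> 'x) \<Rightarrow> 'x set \<Rightarrow> ('x \<Rightarrow> real) \<Rightarrow> bool" where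
  "banach_space_on sc X nrm \<longleftrightarrow>
     vector_space sc \<and> module.subspace sc X \<and>
     (\<forall>v\<in>X. nrm v = 0 \<longleftrightarrow> v = 0) \<and>
     (\<forall>v\<in>X. \<forall>w\<in>X. nrm (v + w) \<le> nrm v + nrm w) \<and>
     (\<forall>c. \<forall>v\<in>X. nrm (sc c v) = norm c * nrm v) \<and>
     (\<forall>s::nat \<Rightarrow> 'x. range s \<subseteq> X \<longrightarrow>
        (\<forall>e>0. \<exists>M. \<forall>m\<ge>M. \<forall>n\<ge>M. nrm (s m - s n) < e) \<longrightarrow>
        (\<exists>v\<in>X. (\<lambda>n. nrm (s n - v)) \<longlonglongrightarrow> 0))"

text \<open>
  Operators on \<open>X\<close> are extensional functions (\<open>undefined\<close> outside \<open>X\<close>), so that equality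
  of functions is equality of operators.
\<close>

definition bounded_ops ::
  "('k::real_normed_field \<Rightarrow> 'x::ab_group_add \<Rightarrow> 'x) \<Rightarrow> 'x set \<Rightarrow> ('x \<Rightarrow> real) \<Rightarrow> ('x \<Rightarrow> 'x) set" where
  "bounded_ops sc X nrm =
     {T \<in> X \<rightarrow>\<^sub>E X.
        (\<forall>v\<in>X. \<forall>w\<in>X. T (v + w) = T v + T w) \<and>
        (\<forall>c. \<forall>v\<in>X. T (sc c v) = sc c (T v)) \<and>
        (\<exists>C. \<forall>v\<in>X. nrm (T v) \<le> C * nrm v)}"

definition op_norm :: "'x set \<Rightarrow> ('x \<Rightarrow> real) \<Rightarrow> ('x \<Rightarrow> 'x) \<Rightarrow> real" where
  "op_norm X nrm T = Sup {nrm (T v) | v. v \<in> X \<and> nrm v \<le> 1}"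

definition op_monoid ::
  "('k::real_normed_field \<Rightarrow> 'x::ab_group_add \<Rightarrow> 'x) \<Rightarrow> 'x set \<Rightarrow> ('x \<Rightarrow> real) \<Rightarrow> ('x \<Rightarrow> 'x) monoid" where
  "op_monoid sc X nrm =
     \<lparr>carrier = bounded_ops sc X nrm, mult = compose X, one = (\<lambda>v\<in>X. v)\<rparr>"


section \<open>Nilpotent Banach-Lie algebras\<close>

text \<open>
  The assumption \<open>sc_of_real\<close> says that the real structure of the type class \<^class>\<open>banach\<close>
  is the restriction of the \<open>'k\<close>-structure.
\<close>

locale banach_lie_algebra =
  fixes sc :: "'k::real_normed_field \<Rightarrow> 'g::banach \<Rightarrow> 'g"
    and br :: "'g \<Rightarrow> 'g \<Rightarrow> 'g"
  assumes banach: "banach_space_on sc UNIV norm"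
    and sc_of_real: "\<And>r x. sc (of_real r) x = r *\<^sub>R x"
    and linear_right: "\<And>x. Vector_Spaces.linear sc sc (\<lambda>y. br x y)"
    and linear_left: "\<And>y. Vector_Spaces.linear sc sc (\<lambda>x. br x y)"
    and alternating: "\<And>x. br x x = 0"
    and jacobi: "\<And>x y z. br x (br y z) + br y (br z x) + br z (br x y) = 0"
    and continuous_bracket: "continuous_on UNIV (\<lambda>p. br (fst p) (snd p))"

text \<open>
  The descending central series is indexed from 1; the value at 0 is a dummy. As usual, the
  bracket of two subspaces is the linear span of the brackets of their elements; taking
  closed spans instead does not change which terms are zero.
\<close>

fun lcs :: "('k::real_normed_field \<Rightarrow> 'g::banach \<Rightarrow> 'g) \<Rightarrow> ('g \<Rightarrow> 'g \<Rightarrow> 'g) \<Rightarrow> nat \<Rightarrow> 'g set" where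
  "lcs sc br 0 = UNIV"
| "lcs sc br (Suc 0) = UNIV"
| "lcs sc br (Suc (Suc j)) = module.span sc {br x y | x y. y \<in> lcs sc br (Suc j)}"

text \<open>Only meant for \<open>n \<ge> 2\<close>: an abelian nonzero algebra is 2-step nilpotent here.\<close>

definition step_nilpotent ::
  "('k::real_normed_field \<Rightarrow> 'g::banach \<Rightarrow> 'g) \<Rightarrow> ('g \<Rightarrow> 'g \<Rightarrow> 'g) \<Rightarrow> nat \<Rightarrow> bool" where
  "step_nilpotent sc br n \<longleftrightarrow> lcs sc br (n - 1) \<noteq> {0} \<and> lcs sc br n = {0}"


section \<open>The Baker-Campbell-Hausdorff multiplication\<close>

text \<open>
  Dynkin's form of the Baker-Campbell-Hausdorff series, with \<open>p\<^sub>i + q\<^sub>i > 0\<close>: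
  \[ x * y = x + \sum_{k, m \ge 0} \sum_{p_i, q_i}
       \frac{(-1)^k}{(k+1)(q_1 + \dots + q_k + 1)}
       \frac{(ad\, x)^{p_1} (ad\, y)^{q_1} \cdots (ad\, x)^{p_k} (ad\, y)^{q_k} (ad\, x)^m}
            {p_1!\, q_1! \cdots p_k!\, q_k!\, m!} \; y. \]
  (It is the termwise integral of \<open>x * y = x + \<integral>\<^sub>0\<^sup>1 \<psi> (exp (ad x) exp (t ad y)) y dt\<close> with
  \<open>\<psi> z = z log z / (z - 1)\<close>, see Hilgert and Neeb,
  Structure and Geometry of Lie Groups.)
  The list \<open>pq\<close> holds the pairs \<open>(p\<^sub>i, q\<^sub>i)\<close>. A summand applies
  \<open>\<Sum>(p\<^sub>i + q\<^sub>i) + m\<close> brackets to \<open>y\<close>, hence lies in the term of the central series with index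
  one more than this number. So if the term with index \<open>N + 1\<close> is zero, then
  all summands omitted from the truncation below vanish and it equals the full series.
\<close>

definition bch_index :: "nat \<Rightarrow> ((nat \<times> nat) list \<times> nat) set" where
  "bch_index N = {(pq, m). (\<forall>(p, q)\<in>set pq. p + q > 0) \<and> (\<Sum>(p, q)\<leftarrow>pq. p + q) + m < N}"

definition bch_coeff :: "(nat \<times> nat) list \<Rightarrow> nat \<Rightarrow> real" where
  "bch_coeff pq m =
     (- 1) ^ length pq /
     (real (length pq + 1) * real ((\<Sum>(p, q)\<leftarrow>pq. q) + 1) *
      (\<Prod>(p, q)\<leftarrow>pq. fact p * fact q) * fact m)"

definition bch_word ::
  "('g \<Rightarrow> 'g \<Rightarrow> 'g) \<Rightarrow> 'g \<Rightarrow> 'g \<Rightarrow> (nat \<times> nat) list \<Rightarrow> nat \<Rightarrow> 'g" where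
  "bch_word br x y pq m =
     foldr (\<lambda>(p, q) z. (br x ^^ p) ((br y ^^ q) z)) pq ((br x ^^ m) y)"

definition bch :: "nat \<Rightarrow> ('g::banach \<Rightarrow> 'g \<Rightarrow> 'g) \<Rightarrow> 'g \<Rightarrow> 'g \<Rightarrow> 'g" where
  "bch N br x y = x + (\<Sum>(pq, m)\<in>bch_index N. bch_coeff pq m *\<^sub>R bch_word br x y pq m)"

text \<open>
  The connected, simply connected group with Lie algebra \<open>(\<open>'g\<close>, br)\<close>, where the central
  series vanishes from index \<open>N + 1\<close> on; its topology is the norm topology of \<open>'g\<close>.
\<close>

definition bch_group :: "nat \<Rightarrow> ('g::banach \<Rightarrow> 'g \<Rightarrow> 'g) \<Rightarrow> 'g monoid" where
  "bch_group N br = \<lparr>carrier = UNIV, mult = bch N br, one = 0\<rparr>"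


section \<open>Representations\<close>

definition norm_continuous_rep ::
  "'g::banach monoid \<Rightarrow> ('k::real_normed_field \<Rightarrow> 'x::ab_group_add \<Rightarrow> 'x) \<Rightarrow> 'x set \<Rightarrow>
   ('x \<Rightarrow> real) \<Rightarrow> ('g \<Rightarrow> 'x \<Rightarrow> 'x) \<Rightarrow> bool" where
  "norm_continuous_rep G scX X nrm \<pi> \<longleftrightarrow>
     \<pi> \<in> hom G (units_of (op_monoid scX X nrm)) \<and>
     (\<forall>g\<in>carrier G.
        ((\<lambda>h. op_norm X nrm (\<lambda>v. \<pi> h v - \<pi> g v)) \<longlongrightarrow> 0) (at g within carrier G))"

definition unipotent_rep ::
  "'g monoid \<Rightarrow> 'x::ab_group_add set \<Rightarrow> ('g \<Rightarrow> 'x \<Rightarrow> 'x) \<Rightarrow> nat \<Rightarrow> bool" where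
  "unipotent_rep G X \<pi> q \<longleftrightarrow> (\<forall>g\<in>carrier G. \<forall>v\<in>X. ((\<lambda>w. \<pi> g w - w) ^^ q) v = 0)"

definition bounded_lie_rep ::
  "('k::real_normed_field \<Rightarrow> 'g::banach \<Rightarrow> 'g) \<Rightarrow> ('g \<Rightarrow> 'g \<Rightarrow> 'g) \<Rightarrow>
   ('k \<Rightarrow> 'x::ab_group_add \<Rightarrow> 'x) \<Rightarrow> 'x set \<Rightarrow> ('x \<Rightarrow> real) \<Rightarrow> ('g \<Rightarrow> 'x \<Rightarrow> 'x) \<Rightarrow> bool" where
  "bounded_lie_rep sc br scX X nrm \<rho> \<longleftrightarrow>
     range \<rho> \<subseteq> bounded_ops scX X nrm \<and>
     (\<forall>x y. \<forall>v\<in>X. \<rho> (x + y) v = \<rho> x v + \<rho> y v) \<and>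
     (\<forall>c x. \<forall>v\<in>X. \<rho> (sc c x) v = scX c (\<rho> x v)) \<and>
     (\<forall>x y. \<forall>v\<in>X. \<rho> (br x y) v = \<rho> x (\<rho> y v) - \<rho> y (\<rho> x v)) \<and>
     (\<exists>C. \<forall>x. op_norm X nrm (\<rho> x) \<le> C * norm x)"

definition nilpotent_rep :: "'x::ab_group_add set \<Rightarrow> ('g \<Rightarrow> 'x \<Rightarrow> 'x) \<Rightarrow> nat \<Rightarrow> bool" where
  "nilpotent_rep X \<rho> q \<longleftrightarrow> (\<forall>x. \<forall>v\<in>X. (\<rho> x ^^ q) v = 0)"

text \<open>
  Types cannot be quantified existentially in HOL. To assert that a Banach space exists, we
  assert that one is carried by a linear subspace \<open>X\<close> of the vector space of all functions
  \<open>'g \<Rightarrow> 'g\<close> with pointwise addition. The norm is arbitrary, and so is the scalar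
  multiplication.
\<close>

type_synonym 'g rep_vec = "'g \<Rightarrow> 'g"

end

theory Submission
  imports Defs
begin

text \<open>
  Both bounds hold with \<open>N + 1\<close> in place of \<open>2 ^ (N - 1) * N + 1\<close>, on one and the same
  Banach space \<open>X\<close>. Its elements are the functions \<open>f\<close> from finite words in \<open>\<gg>\<close> to \<open>\<gg>\<close> that are
  multilinear and bounded, satisfy \<open>f (\<dots> a b \<dots>) - f (\<dots> b a \<dots>) = f (\<dots> [a, b] \<dots>)\<close>, and vanish on
  words longer than \<open>N\<close>: the bounded linear maps into \<open>\<gg>\<close> from the enveloping algebra of \<open>\<gg>\<close>
  modulo products of more than \<open>N\<close> elements (\<open>word_form\<close>). Appending a letter, \<open>(\<rho> x f) l = f (l x)\<close>,
  is a bounded representation of \<open>\<gg>\<close>; a product of \<open>N + 1\<close> operators \<open>\<rho> x\<close> is zero since it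
  evaluates \<open>f\<close> on words longer than \<open>N\<close>. The group acts by \<open>\<pi> x = exp (\<rho> x)\<close>, and
  \<open>(\<pi> x - 1) ^ (N + 1) = 0\<close> because \<open>\<pi> x - 1\<close> also evaluates \<open>f\<close> on longer words only.
  Two things need work.

  Faithfulness of \<open>\<rho>\<close>. One element \<open>f\<close> of \<open>X\<close> with \<open>f [x] = x\<close> is enough; it replaces the theorem of
  Poincare, Birkhoff and Witt. For \<open>a \<in> \<gg>\<close> let \<open>v\<^sub>a\<close> be the polynomial vector field
  \<open>v\<^sub>a (y) = ad y / (1 - exp (- ad y)) a\<close>, that is, the left-invariant field of the group in
  exponential coordinates. The Maurer-Cartan equation, proved by comparing coefficients of the series
  \<open>(1 - exp (- s ad y)) / ad y\<close> in \<open>s\<close>, shows that the commutator of \<open>v\<^sub>a\<close> and \<open>v\<^sub>b\<close> is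
  the field of \<open>[a, b]\<close> (\<open>inv_field_bracket\<close>). Hence the map that sends a word \<open>a\<^sub>1 \<dots> a\<^sub>k\<close> to the value at \<open>0\<close> of the identity, differentiated along the
  fields of \<open>a\<^sub>k, \<dots>, a\<^sub>1\<close> in this order, satisfies the relations
  (\<open>chart_form\<close>). It is bounded and vanishes on long words because the iterated derivatives of the
  identity are sums of Lie words in \<open>y\<close> and the \<open>a\<^sub>i\<close>, in which each \<open>a\<^sub>i\<close> occurs (\<open>lie_poly\<close>).

  The homomorphism property of \<open>\<pi>\<close> for Dynkin's multiplication. Let \<open>Z t\<close> be the integral curve
  of \<open>v\<^sub>y\<close> with \<open>Z 0 = x\<close> (\<open>flow\<close>), a polynomial in \<open>t\<close> given by its Taylor series. By the formula for the
  derivative of the exponential, \<open>\<pi> (Z t)\<close> and \<open>\<pi> x \<circ> \<pi> (t y)\<close> solve the same linear differential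
  equation, so they agree (\<open>exp_act_flow\<close>). The same argument for the adjoint representation gives
  \<open>exp (ad (Z t)) = exp (ad x) exp (t ad y)\<close>. Inserting this in \<open>Z' = v\<^sub>y (Z)\<close>, with
  \<open>z / (1 - exp (- z)) = \<Sum>\<^sub>k (- 1) ^ k / (k + 1) (exp z - 1) ^ k exp z\<close>, and integrating termwise
  yields Dynkin's series, so \<open>Z 1 = x * y\<close> (\<open>flow_eq_bch\<close>). Finally \<open>\<pi>\<close> is injective because
  \<open>\<pi> x\<close>, applied to the element \<open>f\<close> above and evaluated on the empty word, is the flow of \<open>v\<^sub>x\<close>
  from \<open>0\<close> at time 1, which is \<open>0 * x = x\<close>.

  A word is encoded as a point of \<open>\<gg>\<close> through a bijection between finite words in \<open>\<gg>\<close> and \<open>\<gg>\<close>, which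
  turns \<open>X\<close> into a space of functions \<open>\<gg> \<Rightarrow> \<gg>\<close>.
\<close>

section \<open>Convolution sums\<close>

text \<open>
  The product rule \<open>(A B)' = A' B + A B'\<close> for power series in one variable \<open>s\<close>, read off at the
  coefficient of \<open>s ^ n\<close>; here \<open>g i j\<close> stands for the product of the coefficients with index \<open>i\<close> and \<open>j\<close>.
\<close>

lemma sum_convolution_Suc:
  fixes g :: "nat \<Rightarrow> nat \<Rightarrow> 'v::real_vector"
  shows "real (Suc n) *\<^sub>R (\<Sum>i\<le>Suc n. g i (Suc n - i)) =
    (\<Sum>i\<le>n. real (Suc i) *\<^sub>R g (Suc i) (n - i)) + (\<Sum>i\<le>n. real (Suc (n - i)) *\<^sub>R g i (Suc (n - i)))"
proof -
  have "real (Suc n) *\<^sub>R (\<Sum>i\<le>Suc n. g i (Suc n - i)) =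
      (\<Sum>i\<le>Suc n. real i *\<^sub>R g i (Suc n - i)) + (\<Sum>i\<le>Suc n. real (Suc n - i) *\<^sub>R g i (Suc n - i))"
    unfolding scaleR_sum_right sum.distrib[symmetric]
    by (intro sum.cong refl) (simp add: scaleR_left_distrib[symmetric] of_nat_diff)
  also have "(\<Sum>i\<le>Suc n. real i *\<^sub>R g i (Suc n - i)) = (\<Sum>i\<le>n. real (Suc i) *\<^sub>R g (Suc i) (n - i))"
    by (subst sum.atMost_Suc_shift) simp
  also have "(\<Sum>i\<le>Suc n. real (Suc n - i) *\<^sub>R g i (Suc n - i))
      = (\<Sum>i\<le>n. real (Suc (n - i)) *\<^sub>R g i (Suc (n - i)))"
    unfolding sum.atMost_Suc by (simp add: Suc_diff_le del: of_nat_Suc)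
  finally show ?thesis .
qed

lemma sum_square_diagonals:
  fixes g :: "nat \<Rightarrow> nat \<Rightarrow> 'v::comm_monoid_add"
  assumes "\<And>i j. N < i \<or> N < j \<Longrightarrow> g i j = 0"
  shows "(\<Sum>n\<le>2 * N. \<Sum>i\<le>n. g i (n - i)) = (\<Sum>i\<le>N. \<Sum>j\<le>N. g i j)"
proof -
  have fin: "finite {(i, j). i + j \<le> 2 * N}"
    by (rule finite_subset[of _ "{..2*N} \<times> {..2*N}"]) auto
  have "(\<Sum>i\<le>N. \<Sum>j\<le>N. g i j) = (\<Sum>(i, j)\<in>{..N} \<times> {..N}. g i j)"
    by (simp add: sum.cartesian_product)
  also have "\<dots> = (\<Sum>(i, j)\<in>{(i, j). i + j \<le> 2 * N}. g i j)"
    by (rule sum.mono_neutral_left[OF fin]) (auto intro!: assms)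
  finally show ?thesis by (simp only: sum.triangle_reindex_eq)
qed

section \<open>Power series in a nilpotent operator\<close>

text \<open>
  The value \<open>f(T) w\<close> of a power series at an operator with \<open>T ^ (N + 1) = 0\<close>; the series is cut
  off at degree \<open>N\<close>.
\<close>

definition nil_eval :: "nat \<Rightarrow> real fps \<Rightarrow> ('v::real_vector \<Rightarrow> 'v) \<Rightarrow> 'v \<Rightarrow> 'v" where
  "nil_eval N f T w = (\<Sum>n\<le>N. fps_nth f n *\<^sub>R (T ^^ n) w)"

lemma linear_funpow:
  fixes T :: "'v::real_vector \<Rightarrow> 'v"
  assumes "linear T" shows "linear (T ^^ n)"
proof (induction n)
  case 0
  show ?case using linear_id by (simp add: id_def)
next
  case (Suc n)
  then show ?case using linear_compose[OF Suc assms] by (simp add: o_def)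
qed

lemma linear_nil_eval:
  assumes "linear T" shows "linear (nil_eval N f T)"
  unfolding nil_eval_def[abs_def]
  by (intro linear_compose_sum ballI linear_compose_scale_right linear_funpow[OF assms])

lemma nil_eval_mult:
  assumes T: "linear T" and nil: "\<And>n w. n > N \<Longrightarrow> (T ^^ n) w = 0"
  shows "nil_eval N (f * g) T w = nil_eval N f T (nil_eval N g T w)"
proof -
  define h where "h i j = (fps_nth f i * fps_nth g j) *\<^sub>R (T ^^ (i + j)) w" for i j
  have z: "h i j = 0" if "N < i \<or> N < j" for i j
    using that nil[of "i + j" w] by (force simp: h_def)
  have "nil_eval N (f * g) T w = (\<Sum>n\<le>2 * N. fps_nth (f * g) n *\<^sub>R (T ^^ n) w)"
    unfolding nil_eval_def by (rule sum.mono_neutral_left) (auto intro!: nil)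
  also have "\<dots> = (\<Sum>n\<le>2 * N. \<Sum>i\<le>n. h i (n - i))"
    by (intro sum.cong refl) (simp add: fps_mult_nth scaleR_sum_left h_def atMost_atLeast0)
  also have "\<dots> = (\<Sum>i\<le>N. \<Sum>j\<le>N. h i j)"
    by (rule sum_square_diagonals) (rule z)
  also have "\<dots> = nil_eval N f T (nil_eval N g T w)"
    unfolding nil_eval_def
    by (simp add: h_def linear_sum[OF linear_funpow[OF T]] linear_scale[OF linear_funpow[OF T]]
        scaleR_sum_right funpow_add)
  finally show ?thesis .
qed

lemma nil_eval_add: "nil_eval N (f + g) T w = nil_eval N f T w + nil_eval N g T w"
  by (simp add: nil_eval_def scaleR_left_distrib sum.distrib)

lemma nil_eval_diff: "nil_eval N (f - g) T w = nil_eval N f T w - nil_eval N g T w"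
  by (simp add: nil_eval_def scaleR_left_diff_distrib sum_subtractf)

lemma nil_eval_sum: "nil_eval N (\<Sum>k\<in>A. f k) T w = (\<Sum>k\<in>A. nil_eval N (f k) T w)"
  by (induction A rule: infinite_finite_induct) (simp_all add: nil_eval_add, simp_all add: nil_eval_def)

lemma nil_eval_cmult: "nil_eval N (fps_const c * f) T w = c *\<^sub>R nil_eval N f T w"
  by (simp add: nil_eval_def scaleR_sum_right)

lemma nil_eval_eq_one:
  assumes "\<And>n. n \<le> N \<Longrightarrow> fps_nth f n = (if n = 0 then 1 else 0)"
  shows "nil_eval N f T w = w"
proof -
  have "nil_eval N f T w = (\<Sum>n\<le>N. if n = 0 then w else 0)"
    unfolding nil_eval_def by (intro sum.cong refl) (simp add: assms)
  then show ?thesis by simp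
qed

lemma nil_eval_power:
  assumes T: "linear T" and nil: "\<And>n w. n > N \<Longrightarrow> (T ^^ n) w = 0"
  shows "nil_eval N (f ^ k * g) T w = (nil_eval N f T ^^ k) (nil_eval N g T w)"
  by (induction k) (simp_all add: mult.assoc nil_eval_mult[OF assms])

text \<open>
  The series \<open>(1 - exp (- z)) / z\<close>: at \<open>z = ad y\<close> it is the derivative of the exponential map at \<open>y\<close>,
  translated to the identity from the left.
\<close>

definition dexp_fps :: "real fps" where
  "dexp_fps = Abs_fps (\<lambda>n. (- 1) ^ n / fact (Suc n))"

text \<open>
  The reciprocal \<open>z / (1 - exp (- z))\<close> up to degree \<open>N\<close>, written as a truncation of
  \<open>w log w / (w - 1)\<close> at \<open>w = exp z\<close> because Dynkin's series has this shape.
\<close>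

definition dlog_fps :: "nat \<Rightarrow> real fps" where
  "dlog_fps N = (\<Sum>k\<le>N. fps_const ((- 1) ^ k / real (k + 1)) * ((fps_exp 1 - 1) ^ k * fps_exp 1))"

text \<open>
  With \<open>u = exp z - 1\<close>, the product times \<open>z\<close> is the truncated logarithm
  \<open>L = \<Sum>\<^bsub>k \<le> N\<^esub> (- 1) ^ k u ^ (k + 1) / (k + 1)\<close>, whose derivative is \<open>1 - (- u) ^ (N + 1)\<close>.
\<close>

lemma dlog_dexp:
  assumes "n \<le> N"
  shows "fps_nth (dlog_fps N * dexp_fps) n = (if n = 0 then 1 else 0)"
proof -
  define u :: "real fps" where "u = fps_exp 1 - 1"
  define L where "L = (\<Sum>k\<le>N. fps_const ((- 1) ^ k / real (k + 1)) * u ^ Suc k)"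
  have e: "fps_exp (1::real) * fps_exp (- 1) = 1"
    by (simp add: fps_exp_add_mult[symmetric])
  have X: "fps_X * dexp_fps = 1 - fps_exp (- 1)"
  proof (rule fps_ext)
    fix n show "fps_nth (fps_X * dexp_fps) n = fps_nth (1 - fps_exp (- 1)) n"
      by (cases n) (simp_all add: dexp_fps_def distrib_right)
  qed
  have "fps_X * (dlog_fps N * dexp_fps) = dlog_fps N * (1 - fps_exp (- 1))"
    by (simp add: X[symmetric] mult_ac)
  also have "\<dots> = L"
    unfolding dlog_fps_def L_def sum_distrib_right
  proof (intro sum.cong refl)
    fix k
    have "fps_exp 1 * (1 - fps_exp (- 1)) = u" by (simp add: u_def right_diff_distrib e)
    then show "fps_const ((- 1) ^ k / real (k + 1)) * ((fps_exp 1 - 1) ^ k * fps_exp 1) * (1 - fps_exp (- 1)) =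
         fps_const ((- 1) ^ k / real (k + 1)) * u ^ Suc k"
      by (simp add: u_def[symmetric] mult.assoc mult.commute[of u])
  qed
  finally have XL: "fps_X * (dlog_fps N * dexp_fps) = L" .
  have du: "fps_deriv u = 1 + u" by (simp add: u_def)
  have "fps_deriv L = (\<Sum>k\<le>N. (- u) ^ k * (1 + u))"
    unfolding L_def fps_deriv_sum
  proof (intro sum.cong refl)
    fix k
    have "fps_deriv (u ^ Suc k) = fps_const (real (Suc k)) * ((1 + u) * u ^ k)"
      by (simp only: fps_deriv_power du) (simp add: mult_ac)
    then have "fps_deriv (fps_const ((- 1) ^ k / real (k + 1)) * u ^ Suc k) =
        fps_const ((- 1) ^ k / real (k + 1)) * (fps_const (real (Suc k)) * ((1 + u) * u ^ k))"
      by (simp only: fps_deriv_mult_const_left)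
    also have "\<dots> = fps_const ((- 1) ^ k) * ((1 + u) * u ^ k)"
      by (simp add: mult.assoc[symmetric])
    also have "\<dots> = (- u) ^ k * (1 + u)"
      by (cases "even k") (simp_all add: mult_ac fps_const_neg[of "1::real", symmetric] del: fps_const_neg)
    finally show "fps_deriv (fps_const ((- 1) ^ k / real (k + 1)) * u ^ Suc k) = (- u) ^ k * (1 + u)" .
  qed
  also have "\<dots> = 1 - (- u) ^ Suc N"
    using one_diff_power_eq[of "- u" "Suc N"]
    by (simp add: sum_distrib_left lessThan_Suc_atMost mult.commute)
  finally have dL: "fps_deriv L = 1 - (- u) ^ Suc N" .
  have u0: "fps_nth (- u) 0 = 0" by (simp add: u_def)
  have "fps_nth ((- u) ^ Suc N) n = 0"
    using startsby_zero_power_prefix[OF u0, of "Suc N"] assms by simp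
  then have "fps_nth (fps_deriv L) n = (if n = 0 then 1 else 0)"
    by (simp add: dL)
  moreover have "fps_nth (fps_deriv L) n = real (Suc n) * fps_nth (dlog_fps N * dexp_fps) n"
    unfolding XL[symmetric] fps_deriv_nth by (simp only: fps_X_mult_nth) simp
  ultimately show ?thesis by (auto split: if_splits)
qed

section \<open>Nilpotent Banach-Lie algebras\<close>

text \<open>
  Only an upper bound on the nilpotency class is assumed here: the central series vanishes from
  index \<open>N + 1\<close> on.
\<close>

locale nilpotent_banach_lie_algebra = banach_lie_algebra sc br
  for sc :: "'k::real_normed_field \<Rightarrow> 'g::banach \<Rightarrow> 'g" and br :: "'g \<Rightarrow> 'g \<Rightarrow> 'g" +
  fixes N :: nat
  assumes lcs_vanish: "lcs sc br (Suc N) = {0}"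
begin

lemma vector_space_sc: "vector_space sc"
  using banach by (simp add: banach_space_on_def)

lemma norm_sc: "norm (sc c x) = norm c * norm x"
  using banach by (simp add: banach_space_on_def)

lemma
  shows sc_add_right: "sc c (x + y) = sc c x + sc c y"
    and sc_diff_right: "sc c (x - y) = sc c x - sc c y"
    and sc_zero_right [simp]: "sc c 0 = 0"
    and sc_sum_right: "sc c (sum f A) = (\<Sum>a\<in>A. sc c (f a))"
    and sc_one: "sc 1 x = x"
    and sc_mult: "sc c (sc d x) = sc (c * d) x"
proof -
  interpret vector_space sc by (rule vector_space_sc)
  show "sc c (x + y) = sc c x + sc c y" by (rule scale_right_distrib)
  show "sc c (x - y) = sc c x - sc c y" by (rule scale_right_diff_distrib)
  show "sc c 0 = 0" by simp
  show "sc c (sum f A) = (\<Sum>a\<in>A. sc c (f a))" by (rule scale_sum_right)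
  show "sc 1 x = x" by simp
  show "sc c (sc d x) = sc (c * d) x" by simp
qed

lemma sc_scaleR: "sc c (r *\<^sub>R x) = r *\<^sub>R sc c x"
  by (simp add: sc_of_real[symmetric] sc_mult mult.commute)

lemma bounded_linear_sc: "bounded_linear (sc c)"
  by (rule bounded_linear_intro[where K = "norm c"])
    (simp_all add: sc_add_right sc_scaleR norm_sc)

lemma
  shows br_add_right: "br x (y + z) = br x y + br x z"
    and br_sc_right: "br x (sc c y) = sc c (br x y)"
    and br_add_left: "br (x + y) z = br x z + br y z"
    and br_sc_left: "br (sc c x) y = sc c (br x y)"
proof -
  interpret R: Vector_Spaces.linear sc sc "br x" by (rule linear_right)
  interpret L: Vector_Spaces.linear sc sc "\<lambda>x. br x z" for z by (rule linear_left)
  show "br x (y + z) = br x y + br x z" "br x (sc c y) = sc c (br x y)"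
    "br (x + y) z = br x z + br y z" "br (sc c x) y = sc c (br x y)"
    by (simp_all add: R.add R.scale L.add L.scale)
qed

lemma
  shows br_scaleR_right: "br x (r *\<^sub>R y) = r *\<^sub>R br x y"
    and br_scaleR_left: "br (r *\<^sub>R x) y = r *\<^sub>R br x y"
  using br_sc_right br_sc_left by (simp_all add: sc_of_real[symmetric])

lemma bounded_bilinear_br: "bounded_bilinear br"
proof -
  have lin: "br 0 y = 0" "br y 0 = 0" for y
    using br_scaleR_left[of 0 0 y] br_scaleR_right[of y 0 0] by simp_all
  have "((\<lambda>p. br (fst p) (snd p)) \<longlongrightarrow> br 0 0) (at (0, 0))"
    using continuous_bracket by (auto simp: continuous_on_def)
  then obtain d where d: "d > 0" "\<And>p. p \<noteq> (0, 0) \<Longrightarrow> dist p (0, 0) < d \<Longrightarrow> dist (br (fst p) (snd p)) (br 0 0) < 1"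
    by (auto simp: tendsto_iff eventually_at dest!: spec[of _ 1])
  \<comment> \<open>continuity at the origin, rescaled by bilinearity\<close>
  have small: "norm (br x y) \<le> 1" if "norm x \<le> d / 3" "norm y \<le> d / 3" for x y
  proof (cases "(x, y) = (0, 0)")
    case False
    have "dist (x, y) (0, 0) \<le> norm x + norm y"
      by (simp add: dist_norm norm_Pair sqrt_sum_squares_le_sum)
    also have "\<dots> < d" using that d(1) by simp
    finally show ?thesis using d(2)[OF False] by (simp add: lin dist_norm)
  qed (simp add: lin)
  have "norm (br x y) \<le> norm x * norm y * (9 / d\<^sup>2)" for x y
  proof (cases "x = 0 \<or> y = 0")
    case False
    define a where "a = d / (3 * norm x)"
    define b where "b = d / (3 * norm y)"
    have ab: "a > 0" "b > 0" using False d(1) by (simp_all add: a_def b_def)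
    have "norm (br (a *\<^sub>R x) (b *\<^sub>R y)) \<le> 1"
      using False d(1) by (intro small) (simp_all add: a_def b_def)
    then have "a * b * norm (br x y) \<le> 1"
      using ab by (simp add: br_scaleR_left br_scaleR_right mult_ac)
    then show ?thesis using False d(1)
      by (simp add: a_def b_def field_simps power2_eq_square)
  qed (auto simp: lin)
  then have "\<exists>K. \<forall>x y. norm (br x y) \<le> norm x * norm y * K" by blast
  then show ?thesis
    by unfold_locales (simp_all add: br_add_left br_add_right br_scaleR_left br_scaleR_right)
qed

sublocale br: bounded_bilinear br by (rule bounded_bilinear_br)

lemma br_skew: "br x y = - br y x"
proof -
  have "br (x + y) (x + y) = 0" by (rule alternating)
  then have "br x y + br y x = 0"
    unfolding br_add_left br_add_right by (simp add: alternating add.commute)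
  then show ?thesis by (rule eq_neg_iff_add_eq_0[THEN iffD2])
qed

lemma jacobi_derivation: "br x (br y z) = br (br x y) z + br y (br x z)"
proof -
  have "br x (br y z) + - br y (br x z) + - br (br x y) z = 0"
    using jacobi[of x y z] unfolding br_skew[of z "br x y"] br_skew[of z x] br.minus_right .
  then show ?thesis by (simp add: algebra_simps)
qed

lemma linear_br: "linear (br x)"
  by (rule bounded_linear.linear[OF br.bounded_linear_right])

lemma ad_sum: "(br x ^^ n) (sum f A) = (\<Sum>a\<in>A. (br x ^^ n) (f a))"
  by (rule linear_sum[OF linear_funpow[OF linear_br]])

lemma ad_scaleR: "(br x ^^ n) (r *\<^sub>R y) = r *\<^sub>R (br x ^^ n) y"
  by (rule linear_scale[OF linear_funpow[OF linear_br]])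

lemma ad_zero [simp]: "(br x ^^ n) 0 = 0"
  by (rule linear_0[OF linear_funpow[OF linear_br]])

subsection \<open>The descending central series\<close>

lemma subspace_lcs: "module.subspace sc (lcs sc br j)"
proof -
  interpret vector_space sc by (rule vector_space_sc)
  show ?thesis
  proof (cases j)
    case (Suc i)
    then show ?thesis by (cases i) (simp_all add: subspace_UNIV subspace_span)
  qed (simp add: subspace_UNIV)
qed

lemma
  shows lcs_zero: "0 \<in> lcs sc br j"
    and lcs_add: "x \<in> lcs sc br j \<Longrightarrow> y \<in> lcs sc br j \<Longrightarrow> x + y \<in> lcs sc br j"
    and lcs_sc: "x \<in> lcs sc br j \<Longrightarrow> sc c x \<in> lcs sc br j"
proof -
  interpret vector_space sc by (rule vector_space_sc)
  show "0 \<in> lcs sc br j" "x \<in> lcs sc br j \<Longrightarrow> y \<in> lcs sc br j \<Longrightarrow> x + y \<in> lcs sc br j"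
    "x \<in> lcs sc br j \<Longrightarrow> sc c x \<in> lcs sc br j"
    using subspace_lcs[of j] by (simp_all add: subspace_0 subspace_add subspace_scale)
qed

lemma lcs_scaleR: "x \<in> lcs sc br j \<Longrightarrow> r *\<^sub>R x \<in> lcs sc br j"
  by (simp add: sc_of_real[symmetric] lcs_sc)

lemma lcs_neg: "x \<in> lcs sc br j \<Longrightarrow> - x \<in> lcs sc br j"
  using lcs_scaleR[of x j "-1"] by simp

lemma lcs_br_Suc: "y \<in> lcs sc br j \<Longrightarrow> br x y \<in> lcs sc br (Suc j)"
proof (cases j)
  case (Suc i)
  interpret vector_space sc by (rule vector_space_sc)
  assume "y \<in> lcs sc br j"
  then show ?thesis unfolding Suc by (auto intro!: span_base)
qed simp

lemma lcs_Suc_induct [consumes 1, case_names base zero add sc]: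
  assumes z: "z \<in> lcs sc br (Suc (Suc j))"
    and base: "\<And>x y. y \<in> lcs sc br (Suc j) \<Longrightarrow> P (br x y)" and zero: "P 0"
    and add: "\<And>x y. P x \<Longrightarrow> P y \<Longrightarrow> P (x + y)" and sc: "\<And>c x. P x \<Longrightarrow> P (sc c x)"
  shows "P z"
proof -
  interpret vector_space sc by (rule vector_space_sc)
  have "z \<in> span {br x y | x y. y \<in> lcs sc br (Suc j)}" using z by simp
  then show ?thesis
    by (induction rule: span_induct_alt) (auto intro!: zero add sc base)
qed

lemma lcs_Suc_subset: "lcs sc br (Suc j) \<subseteq> lcs sc br j"
proof (induction j)
  case (Suc j)
  show ?case
  proof
    fix z assume "z \<in> lcs sc br (Suc (Suc j))"
    then show "z \<in> lcs sc br (Suc j)"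
      by (induction rule: lcs_Suc_induct)
        (use Suc in \<open>auto intro: lcs_br_Suc lcs_zero lcs_add lcs_sc\<close>)
  qed
qed simp

lemma lcs_antimono: "i \<le> j \<Longrightarrow> lcs sc br j \<subseteq> lcs sc br i"
  by (rule lift_Suc_antimono_le[where f = "lcs sc br"]) (rule lcs_Suc_subset)

text \<open>
  For \<open>i = 0\<close> the statement uses the dummy value of the series at 0, the whole algebra; it then
  says that the terms of the series are ideals.
\<close>

lemma lcs_br: "x \<in> lcs sc br i \<Longrightarrow> y \<in> lcs sc br j \<Longrightarrow> br x y \<in> lcs sc br (i + j)"
proof (induction i arbitrary: x y j rule: less_induct)
  case (less i)
  consider "i = 0" | "i = 1" | k where "i = Suc (Suc k)" by (cases i) (auto, metis not0_implies_Suc)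
  then show ?case
  proof cases
    case 1
    then show ?thesis using lcs_br_Suc[OF less.prems(2)] lcs_Suc_subset[of j] by auto
  next
    case 2
    then show ?thesis using lcs_br_Suc[OF less.prems(2)] by simp
  next
    case 3
    from less.prems(1)[unfolded 3] show ?thesis
    proof (induction rule: lcs_Suc_induct)
      case (base a b)
      have "br a (br b y) \<in> lcs sc br (Suc (Suc k + j))"
        by (intro lcs_br_Suc less.IH) (use base less.prems 3 in simp_all)
      moreover have "br b (br a y) \<in> lcs sc br (Suc k + Suc j)"
        by (intro lcs_br_Suc less.IH) (use base less.prems 3 in simp_all)
      ultimately have "br a (br b y) + - br b (br a y) \<in> lcs sc br (i + j)"
        by (intro lcs_add lcs_neg) (simp_all add: 3)
      then show ?case using jacobi_derivation[of a b y] by simp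
    qed (simp_all add: br.zero_left br_add_left br_sc_left lcs_zero lcs_add lcs_sc)
  qed
qed

lemma lcs_eq_0: "x \<in> lcs sc br j \<Longrightarrow> N < j \<Longrightarrow> x = 0"
  using lcs_antimono[of "Suc N" j] lcs_vanish by auto

lemma ad_in_lcs: "y \<in> lcs sc br j \<Longrightarrow> (br x ^^ n) y \<in> lcs sc br (n + j)"
  by (induction n) (auto intro: lcs_br_Suc)

lemma ad_vanish: "N \<le> n \<Longrightarrow> (br x ^^ n) y = 0"
  using lcs_eq_0 ad_in_lcs[where j = 1 and n = n and x = x and y = y] by simp

lemma nil_eval_ad_mult:
  "nil_eval N (f * g) (br x) w = nil_eval N f (br x) (nil_eval N g (br x) w)"
  by (rule nil_eval_mult[OF linear_br]) (simp add: ad_vanish)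

section \<open>Lie polynomials\<close>

text \<open>
  Linear combinations of Lie words in the variable \<open>y\<close> and constants. By \<open>lie_poly w m c f\<close>, the
  map \<open>f\<close> can be written such that every word has at least \<open>w\<close> constants and at most \<open>m\<close> letters, and \<open>c\<close> bounds the sum over the words
  of the absolute value of the coefficient times the norms of the constants. The first index yields
  vanishing, the other two yield bounds.
\<close>

inductive lie_poly :: "nat \<Rightarrow> nat \<Rightarrow> real \<Rightarrow> ('g \<Rightarrow> 'g) \<Rightarrow> bool" where
  ident: "lie_poly 0 1 1 (\<lambda>y. y)"
| const: "lie_poly 1 1 (norm a) (\<lambda>y. a)"
| zero: "lie_poly w m 0 (\<lambda>y. 0)"
| brack: "lie_poly w m c f \<Longrightarrow> lie_poly w' m' c' g \<Longrightarrow> lie_poly (w + w') (m + m') (c * c') (\<lambda>y. br (f y) (g y))"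
| add: "lie_poly w m c f \<Longrightarrow> lie_poly w m c' g \<Longrightarrow> lie_poly w m (c + c') (\<lambda>y. f y + g y)"
| scale: "lie_poly w m c f \<Longrightarrow> lie_poly w m (norm k * c) (\<lambda>y. sc k (f y))"
| weaken: "lie_poly w m c f \<Longrightarrow> w' \<le> w \<Longrightarrow> m \<le> m' \<Longrightarrow> c \<le> c' \<Longrightarrow> lie_poly w' m' c' f"

lemma lie_poly_nonneg: "lie_poly w m c f \<Longrightarrow> 0 \<le> c"
  by (induction rule: lie_poly.induct) auto

lemma lie_poly_in_lcs: "lie_poly w m c f \<Longrightarrow> f y \<in> lcs sc br w"
proof (induction rule: lie_poly.induct)
  case (weaken w m c f w' m' c')
  then show ?case using lcs_antimono by blast
qed (auto intro: lcs_zero lcs_br lcs_add lcs_sc)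

lemma lie_poly_bounded:
  obtains K where "\<And>w m c f y. lie_poly w m c f \<Longrightarrow> norm y \<le> 1 \<Longrightarrow> norm (f y) \<le> c * K ^ m"
proof -
  obtain K0 where K0: "K0 > 0" "\<And>x y. norm (br x y) \<le> norm x * norm y * K0"
    using br.pos_bounded by blast
  define K where "K = max 1 K0"
  have K: "K \<ge> 1" "norm (br x y) \<le> norm x * norm y * K" for x y
  proof -
    show "norm (br x y) \<le> norm x * norm y * K"
      by (rule order_trans[OF K0(2)]) (auto intro!: mult_left_mono simp: K_def)
  qed (simp add: K_def)
  \<comment> \<open>a word with \<open>j\<close> letters has \<open>j - 1\<close> brackets; the factor \<open>K\<close> on the left makes up for the missing one\<close>
  have "norm (f y) * K \<le> c * K ^ m" if "lie_poly w m c f" "norm y \<le> 1" for w m c f y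
    using that
  proof (induction rule: lie_poly.induct)
    case (brack w m c f w' m' c' g)
    have "norm (br (f y) (g y)) * K \<le> (norm (f y) * norm (g y) * K) * K"
      using K by (intro mult_right_mono) auto
    also have "\<dots> = (norm (f y) * K) * (norm (g y) * K)" by simp
    also have "\<dots> \<le> (c * K ^ m) * (c' * K ^ m')"
      using brack K(1) lie_poly_nonneg[OF brack(1)] by (intro mult_mono[of "norm (f y) * K"]) simp_all
    finally show ?case by (simp add: power_add mult_ac)
  next
    case (add w m c f c' g)
    have "norm (f y + g y) * K \<le> (norm (f y) + norm (g y)) * K"
      using K(1) by (intro mult_right_mono norm_triangle_ineq) auto
    then show ?case using add by (simp add: distrib_right)
  next
    case (scale w m c f k)
    then show ?case by (simp add: norm_sc mult.assoc mult_left_mono)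
  next
    case (weaken w m c f w' m' c')
    have "c * K ^ m \<le> c' * K ^ m'"
      using weaken K(1) lie_poly_nonneg[OF weaken(1)]
      by (intro mult_mono power_increasing) auto
    then show ?case using weaken by simp
  qed (use K(1) in auto)
  moreover have "norm (f y) \<le> norm (f y) * K" for f :: "'g \<Rightarrow> 'g" and y
    using K(1) mult_left_mono[of 1 K "norm (f y)"] by simp
  ultimately show thesis using that[of K] order_trans by blast
qed

abbreviation lie_polynomial :: "('g \<Rightarrow> 'g) \<Rightarrow> bool" where
  "lie_polynomial f \<equiv> \<exists>w m c. lie_poly w m c f"

lemma lie_polynomial_ident: "lie_polynomial (\<lambda>y. y)"
  and lie_polynomial_const: "lie_polynomial (\<lambda>y. a)"
  by (blast intro: lie_poly.intros)+

lemma lie_polynomial_br: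
  "lie_polynomial f \<Longrightarrow> lie_polynomial g \<Longrightarrow> lie_polynomial (\<lambda>y. br (f y) (g y))"
  by (blast intro: lie_poly.brack)

lemma lie_polynomial_sc: "lie_polynomial f \<Longrightarrow> lie_polynomial (\<lambda>y. sc k (f y))"
  by (blast intro: lie_poly.scale)

lemma lie_polynomial_scaleR: "lie_polynomial f \<Longrightarrow> lie_polynomial (\<lambda>y. r *\<^sub>R f y)"
  using lie_polynomial_sc[of f "of_real r"] by (simp add: sc_of_real)

lemma lie_polynomial_add:
  assumes "lie_polynomial f" "lie_polynomial g" shows "lie_polynomial (\<lambda>y. f y + g y)"
proof -
  obtain w m c w' m' c' where f: "lie_poly w m c f" and g: "lie_poly w' m' c' g"
    using assms by blast
  have "lie_poly (min w w') (max m m') c f" "lie_poly (min w w') (max m m') c' g"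
    using f g by (auto intro: lie_poly.weaken)
  then show ?thesis by (blast intro: lie_poly.add)
qed

lemma lie_poly_sum:
  assumes "finite A" "\<And>i. i \<in> A \<Longrightarrow> lie_poly w m (c i) (f i)"
  shows "lie_poly w m (\<Sum>i\<in>A. c i) (\<lambda>y. \<Sum>i\<in>A. f i y)"
  using assms by (induction rule: finite_induct) (auto intro: lie_poly.zero lie_poly.add)

lemma lie_polynomial_sum:
  assumes "finite A" "\<And>i. i \<in> A \<Longrightarrow> lie_polynomial (f i)"
  shows "lie_polynomial (\<lambda>y. \<Sum>i\<in>A. f i y)"
  using assms
proof (induction rule: finite_induct)
  case (insert i F)
  have "lie_polynomial (\<lambda>y. f i y + (\<Sum>i\<in>F. f i y))"
    by (intro lie_polynomial_add insert) simp_all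
  then show ?case using insert by simp
qed (simp add: lie_polynomial_const)

subsection \<open>Derivatives along vector fields\<close>

text \<open>
  The derivative of \<open>f\<close> along the vector field \<open>h\<close>. On Lie polynomials it is the derivation of the
  bracket that kills constants and sends the identity to \<open>h\<close>.
\<close>

definition field_deriv :: "('g \<Rightarrow> 'g) \<Rightarrow> ('g \<Rightarrow> 'g) \<Rightarrow> 'g \<Rightarrow> 'g" where
  "field_deriv h f y = frechet_derivative f (at y) (h y)"

lemma lie_poly_differentiable: "lie_poly w m c f \<Longrightarrow> f differentiable at y"
proof (induction rule: lie_poly.induct)
  case (brack w m c f w' m' c' g)
  then show ?case using br.FDERIV unfolding differentiable_def by blast
next
  case (scale w m c f k)
  then show ?case using bounded_linear.has_derivative[OF bounded_linear_sc]
    unfolding differentiable_def by blast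
qed auto

lemma lie_polynomial_deriv:
  "lie_polynomial f \<Longrightarrow> (f has_derivative frechet_derivative f (at y)) (at y)"
  using lie_poly_differentiable frechet_derivative_works by blast

lemma field_deriv_eqI: "(f has_derivative f') (at y) \<Longrightarrow> field_deriv h f y = f' (h y)"
  using frechet_derivative_at by (fastforce simp: field_deriv_def)

lemma field_deriv_ident: "field_deriv h (\<lambda>y. y) = h"
  by (rule ext) (rule field_deriv_eqI[OF has_derivative_ident])

lemma field_deriv_const: "field_deriv h (\<lambda>y. a) = (\<lambda>y. 0)"
  by (rule ext) (rule field_deriv_eqI[OF has_derivative_const])

lemma field_deriv_br:
  assumes "lie_polynomial f" "lie_polynomial g"
  shows "field_deriv h (\<lambda>y. br (f y) (g y)) = (\<lambda>y. br (f y) (field_deriv h g y) + br (field_deriv h f y) (g y))"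
  by (rule ext) (subst field_deriv_eqI[OF br.FDERIV[OF lie_polynomial_deriv lie_polynomial_deriv]],
      use assms in \<open>auto simp: field_deriv_def\<close>)

lemma field_deriv_add:
  assumes "lie_polynomial f" "lie_polynomial g"
  shows "field_deriv h (\<lambda>y. f y + g y) = (\<lambda>y. field_deriv h f y + field_deriv h g y)"
  by (rule ext) (subst field_deriv_eqI[OF has_derivative_add[OF lie_polynomial_deriv lie_polynomial_deriv]],
      use assms in \<open>auto simp: field_deriv_def\<close>)

lemma field_deriv_diff:
  assumes "lie_polynomial f" "lie_polynomial g"
  shows "field_deriv h (\<lambda>y. f y - g y) = (\<lambda>y. field_deriv h f y - field_deriv h g y)"
  by (rule ext) (subst field_deriv_eqI[OF has_derivative_diff[OF lie_polynomial_deriv lie_polynomial_deriv]],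
      use assms in \<open>auto simp: field_deriv_def\<close>)

lemma field_deriv_sc:
  assumes "lie_polynomial f"
  shows "field_deriv h (\<lambda>y. sc k (f y)) = (\<lambda>y. sc k (field_deriv h f y))"
  by (rule ext) (subst field_deriv_eqI[OF bounded_linear.has_derivative[OF bounded_linear_sc lie_polynomial_deriv]],
      use assms in \<open>auto simp: field_deriv_def\<close>)

lemma field_deriv_scaleR:
  assumes "lie_polynomial f"
  shows "field_deriv h (\<lambda>y. r *\<^sub>R f y) = (\<lambda>y. r *\<^sub>R field_deriv h f y)"
  using field_deriv_sc[OF assms, of h "of_real r"] by (simp add: sc_of_real)

lemma field_deriv_sum:
  assumes "finite A" "\<And>i. i \<in> A \<Longrightarrow> lie_polynomial (f i)"
  shows "field_deriv h (\<lambda>y. \<Sum>i\<in>A. f i y) = (\<lambda>y. \<Sum>i\<in>A. field_deriv h (f i) y)"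
  using assms
  by (induction rule: finite_induct) (simp_all add: field_deriv_const field_deriv_add lie_polynomial_sum)

lemma field_deriv_field_add:
  assumes "lie_polynomial f"
  shows "field_deriv (\<lambda>y. h y + h' y) f = (\<lambda>y. field_deriv h f y + field_deriv h' f y)"
  using lie_polynomial_deriv[OF assms, THEN has_derivative_bounded_linear]
  by (auto simp: field_deriv_def linear_simps)

lemma field_deriv_field_sc:
  assumes "lie_polynomial f"
  shows "field_deriv (\<lambda>y. sc k (h y)) f = (\<lambda>y. sc k (field_deriv h f y))"
proof -
  obtain w m c where "lie_poly w m c f" using assms by blast
  then show ?thesis
  proof (induction rule: lie_poly.induct)
    case (brack w m c f w' m' c' g)
    then have "lie_polynomial f" "lie_polynomial g" by blast+
    then show ?case by (simp add: field_deriv_br brack.IH br_sc_left br_sc_right sc_add_right)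
  next
    case (add w m c f c' g)
    then have "lie_polynomial f" "lie_polynomial g" by blast+
    then show ?case by (simp add: field_deriv_add add.IH sc_add_right)
  next
    case (scale w m c f j)
    then have "lie_polynomial f" by blast
    then show ?case by (simp add: field_deriv_sc scale.IH sc_mult mult.commute)
  qed (simp_all add: field_deriv_ident field_deriv_const)
qed

text \<open>
  Differentiating along a field whose words contain a constant replaces one letter \<open>y\<close> by such a
  word, hence adds a constant.
\<close>

lemma lie_poly_field_deriv:
  assumes h: "lie_poly 1 (Suc n) C h" and f: "lie_poly w m c f"
  shows "lie_poly (Suc w) (m + n) (real m * c * C) (field_deriv h f)"
  using f
proof (induction rule: lie_poly.induct)
  case ident
  then show ?case using h by (simp add: field_deriv_ident)
next
  case (const a)
  have "lie_poly (Suc 1) (1 + n) 0 (field_deriv h (\<lambda>y. a))"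
    unfolding field_deriv_const by (rule lie_poly.zero)
  then show ?case
    by (rule lie_poly.weaken) (use lie_poly_nonneg[OF h] in auto)
next
  case (zero w m)
  then show ?case by (simp add: field_deriv_const lie_poly.zero)
next
  case (brack w m c f w' m' c' g)
  have "lie_poly (w + Suc w') (m + (m' + n)) (c * (real m' * c' * C)) (\<lambda>y. br (f y) (field_deriv h g y))"
    by (intro lie_poly.brack brack)
  moreover have "lie_poly (Suc w + w') ((m + n) + m') ((real m * c * C) * c') (\<lambda>y. br (field_deriv h f y) (g y))"
    by (intro lie_poly.brack brack)
  ultimately have "lie_poly (Suc (w + w')) (m + m' + n)
      (c * (real m' * c' * C) + (real m * c * C) * c')
      (\<lambda>y. br (f y) (field_deriv h g y) + br (field_deriv h f y) (g y))"
    by (intro lie_poly.add) (simp_all add: add_ac)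
  moreover have "lie_polynomial f" "lie_polynomial g" using brack by blast+
  ultimately show ?case by (simp add: field_deriv_br algebra_simps)
next
  case (add w m c f c' g)
  then have "lie_polynomial f" "lie_polynomial g" by blast+
  then show ?case using lie_poly.add[OF add.IH] by (simp add: field_deriv_add algebra_simps)
next
  case (scale w m c f k)
  then have "lie_polynomial f" by blast
  then show ?case using lie_poly.scale[OF scale.IH, of k] by (simp add: field_deriv_sc algebra_simps)
next
  case (weaken w m c f w' m' c')
  have "real m * c * C \<le> real m' * c' * C"
    using weaken lie_poly_nonneg[OF h] lie_poly_nonneg[OF weaken(1)] by (intro mult_mono) auto
  then show ?case using weaken by (intro lie_poly.weaken[OF weaken.IH]) auto
qed

text \<open>
  Both sides are derivations in \<open>f\<close>, so it suffices that they agree on the identity and on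
  constants.
\<close>

lemma field_deriv_commutator:
  assumes h: "lie_poly 1 (Suc n) C h" "lie_poly 1 (Suc n) C' h'" and f: "lie_polynomial f"
  shows "field_deriv h (field_deriv h' f) y - field_deriv h' (field_deriv h f) y = field_deriv (\<lambda>y. field_deriv h h' y - field_deriv h' h y) f y"
proof -
  obtain w m c where "lie_poly w m c f" using f by blast
  then show ?thesis
  proof (induction arbitrary: y rule: lie_poly.induct)
    case (brack w m c f w' m' c' g)
    then have fg: "lie_polynomial f" "lie_polynomial g" by blast+
    have d: "lie_polynomial (field_deriv h f)" "lie_polynomial (field_deriv h g)"
      "lie_polynomial (field_deriv h' f)" "lie_polynomial (field_deriv h' g)"
      using h brack by (blast intro: lie_poly_field_deriv)+
    show ?case
      by (simp add: field_deriv_br field_deriv_add lie_polynomial_br fg d brack.IH[symmetric]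
          br.diff_left br.diff_right)
  next
    case (add w m c f c' g)
    then have fg: "lie_polynomial f" "lie_polynomial g" by blast+
    have d: "lie_polynomial (field_deriv h f)" "lie_polynomial (field_deriv h g)"
      "lie_polynomial (field_deriv h' f)" "lie_polynomial (field_deriv h' g)"
      using h add by (blast intro: lie_poly_field_deriv)+
    show ?case by (simp add: field_deriv_add fg d add.IH[symmetric])
  next
    case (scale w m c f k)
    then have f: "lie_polynomial f" by blast
    have d: "lie_polynomial (field_deriv h f)" "lie_polynomial (field_deriv h' f)"
      using h scale by (blast intro: lie_poly_field_deriv)+
    show ?case by (simp add: field_deriv_sc f d scale.IH[symmetric] sc_diff_right)
  qed (simp_all add: field_deriv_ident field_deriv_const)
qed

section \<open>Left-invariant vector fields\<close>

text \<open>
  The left-invariant vector field with value \<open>a\<close> at the origin, in exponential coordinates.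
\<close>

definition inv_field :: "'g \<Rightarrow> 'g \<Rightarrow> 'g" where
  "inv_field a y = nil_eval N (dlog_fps N) (br y) a"

abbreviation dexp :: "'g \<Rightarrow> 'g \<Rightarrow> 'g" where
  "dexp y \<equiv> nil_eval N dexp_fps (br y)"

lemma dexp_inv_field: "dexp y (inv_field a y) = a"
  unfolding inv_field_def nil_eval_ad_mult[symmetric] mult.commute[of dexp_fps]
  by (rule nil_eval_eq_one[OF dlog_dexp])

lemma inv_field_dexp: "inv_field (dexp y u) y = u"
  unfolding inv_field_def nil_eval_ad_mult[symmetric]
  by (rule nil_eval_eq_one[OF dlog_dexp])

lemma lie_poly_ad: "lie_poly 1 (Suc n) (norm a) (\<lambda>y. (br y ^^ n) a)"
proof (induction n)
  case 0
  show ?case using lie_poly.const[of a] by simp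
next
  case (Suc n)
  show ?case using lie_poly.brack[OF lie_poly.ident Suc] by simp
qed

text \<open>
  The sum of the absolute values of the coefficients of the invariant fields.
\<close>

definition inv_field_bound :: real where
  "inv_field_bound = (\<Sum>n\<le>N. \<bar>fps_nth (dlog_fps N) n\<bar>)"

lemma lie_poly_inv_field: "lie_poly 1 (Suc N) (inv_field_bound * norm a) (inv_field a)"
proof -
  have "lie_poly 1 (Suc N) (\<Sum>n\<le>N. \<bar>fps_nth (dlog_fps N) n\<bar> * norm a)
      (\<lambda>y. \<Sum>n\<le>N. fps_nth (dlog_fps N) n *\<^sub>R (br y ^^ n) a)"
  proof (rule lie_poly_sum)
    fix n assume n: "n \<in> {..N}"
    have "lie_poly 1 (Suc n) (norm (of_real (fps_nth (dlog_fps N) n) :: 'k) * norm a)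
        (\<lambda>y. sc (of_real (fps_nth (dlog_fps N) n)) ((br y ^^ n) a))"
      by (rule lie_poly.scale[OF lie_poly_ad])
    then show "lie_poly 1 (Suc N) (\<bar>fps_nth (dlog_fps N) n\<bar> * norm a)
        (\<lambda>y. fps_nth (dlog_fps N) n *\<^sub>R (br y ^^ n) a)"
      using n by (auto simp: sc_of_real intro: lie_poly.weaken)
  qed simp
  then show ?thesis
    by (simp add: inv_field_def[abs_def] nil_eval_def inv_field_bound_def sum_distrib_right)
qed

lemma inv_field_add: "inv_field (a + b) = (\<lambda>y. inv_field a y + inv_field b y)"
  by (rule ext) (simp add: inv_field_def linear_add[OF linear_nil_eval[OF linear_br]])

lemma ad_sc: "(br y ^^ n) (sc k a) = sc k ((br y ^^ n) a)"
  by (induction n) (simp_all add: br_sc_right)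

lemma inv_field_sc: "inv_field (sc k a) = (\<lambda>y. sc k (inv_field a y))"
  by (rule ext) (simp add: inv_field_def nil_eval_def ad_sc sc_sum_right sc_scaleR)

subsection \<open>The Maurer-Cartan equation\<close>

text \<open>
  The coefficient of \<open>s ^ j\<close> in \<open>(1 - exp (- s ad y)) / ad y\<close> applied to \<open>u\<close>. As a series in \<open>s\<close> this is
  the solution \<open>F\<close> of \<open>F' = u - [y, F]\<close> with \<open>F 0 = 0\<close>, which is the recursion \<open>dexp_term_Suc\<close>.
\<close>

definition dexp_term :: "'g \<Rightarrow> 'g \<Rightarrow> nat \<Rightarrow> 'g" where
  "dexp_term y u j = (case j of 0 \<Rightarrow> 0 | Suc n \<Rightarrow> fps_nth dexp_fps n *\<^sub>R (br y ^^ n) u)"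

lemma dexp_term_0 [simp]: "dexp_term y u 0 = 0"
  by (simp add: dexp_term_def)

lemma dexp_term_Suc:
  "real (Suc j) *\<^sub>R dexp_term y u (Suc j) = (if j = 0 then u else 0) - br y (dexp_term y u j)"
proof (cases j)
  case (Suc n)
  have "real (Suc (Suc n)) * ((- 1) ^ Suc n / fact (Suc (Suc n))) = - ((- 1) ^ n / fact (Suc n))"
    by (simp add: field_simps del: of_nat_Suc)
  then show ?thesis
    by (simp add: Suc dexp_term_def dexp_fps_def br.scaleR_right scaleR_minus_left[symmetric]
        del: fact_Suc of_nat_Suc scaleR_minus_left)
qed (simp add: dexp_term_def dexp_fps_def br.zero_right)

lemma dexp_term_vanish: "N < j \<Longrightarrow> dexp_term y u j = 0"
  by (auto simp: dexp_term_def ad_vanish split: nat.split)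

lemma dexp_eq_sum: "N \<le> M \<Longrightarrow> dexp y u = (\<Sum>j\<le>M. dexp_term y u j)"
proof -
  assume M: "N \<le> M"
  have "dexp y u = (\<Sum>j\<le>Suc N. dexp_term y u j)"
    by (subst sum.atMost_Suc_shift) (simp add: dexp_term_def nil_eval_def)
  also have "\<dots> = (\<Sum>j\<le>N. dexp_term y u j)" by (simp add: dexp_term_vanish)
  also have "\<dots> = (\<Sum>j\<le>M. dexp_term y u j)"
    using M by (intro sum.mono_neutral_left) (auto simp: dexp_term_vanish)
  finally show ?thesis .
qed

lemma lie_polynomial_ad_funpow:
  "lie_polynomial u \<Longrightarrow> lie_polynomial (\<lambda>y. (br y ^^ n) (u y))"
  by (induction n) (simp_all add: lie_polynomial_br[OF lie_polynomial_ident])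

lemma lie_polynomial_dexp_term:
  assumes "lie_polynomial u" shows "lie_polynomial (\<lambda>y. dexp_term y (u y) j)"
proof (cases j)
  case 0
  show ?thesis unfolding 0 dexp_term_0 by (rule lie_polynomial_const)
next
  case (Suc n)
  show ?thesis unfolding Suc dexp_term_def nat.case
    by (intro lie_polynomial_scaleR lie_polynomial_ad_funpow assms)
qed

text \<open>
  \<open>R n h y\<close> is the derivative along \<open>h\<close> of the coefficient \<open>dexp_term y u n\<close> in its first argument
  alone; the recursion is the derivative of \<open>dexp_term_Suc\<close>.
\<close>

lemma dexp_term_derivative:
  assumes "lie_polynomial u"
  defines "R n h y \<equiv> field_deriv h (\<lambda>y. dexp_term y (u y) n) y - dexp_term y (field_deriv h u y) n"
  shows "real (Suc n) *\<^sub>R R (Suc n) h y = - br (h y) (dexp_term y (u y) n) - br y (R n h y)"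
proof -
  have t: "lie_polynomial (\<lambda>y. dexp_term y (u y) n)" for n
    by (rule lie_polynomial_dexp_term[OF assms(1)])
  have "real (Suc n) *\<^sub>R field_deriv h (\<lambda>y. dexp_term y (u y) (Suc n)) y
      = field_deriv h (\<lambda>y. real (Suc n) *\<^sub>R dexp_term y (u y) (Suc n)) y"
    by (simp only: field_deriv_scaleR[OF t])
  also have "\<dots> = field_deriv h (\<lambda>y. (if n = 0 then u y else 0) - br y (dexp_term y (u y) n)) y"
    by (simp only: dexp_term_Suc)
  also have "\<dots> = field_deriv h (\<lambda>y. if n = 0 then u y else 0) y
      - (br y (field_deriv h (\<lambda>y. dexp_term y (u y) n) y) + br (h y) (dexp_term y (u y) n))"
    using assms(1) by (subst field_deriv_diff) (cases "n = 0",
        simp_all add: lie_polynomial_const lie_polynomial_br lie_polynomial_ident t field_deriv_br field_deriv_ident)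
  also have "field_deriv h (\<lambda>y. if n = 0 then u y else 0) y = (if n = 0 then field_deriv h u y else 0)"
    by (simp add: field_deriv_const)
  finally show ?thesis
    unfolding R_def scaleR_diff_right dexp_term_Suc by (simp add: br.diff_right)
qed

text \<open>
  The Maurer-Cartan equation. The coefficients of the left side, written \<open>R n - S n\<close>, and those of the
  bracket, written \<open>K n\<close>, obey the same recursion. For \<open>K\<close> this uses the Jacobi identity.
\<close>

lemma dexp_exterior_derivative:
  assumes u: "lie_polynomial u" and w: "lie_polynomial w"
  shows "(field_deriv w (\<lambda>y. dexp y (u y)) y - dexp y (field_deriv w u y))
       - (field_deriv u (\<lambda>y. dexp y (w y)) y - dexp y (field_deriv u w y)) = br (dexp y (u y)) (dexp y (w y))"
proof -
  define a b where "a n = dexp_term y (u y) n" and "b n = dexp_term y (w y) n" for n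
  define R where "R n = (field_deriv w (\<lambda>y. dexp_term y (u y) n) y - dexp_term y (field_deriv w u y) n)" for n
  define S where "S n = (field_deriv u (\<lambda>y. dexp_term y (w y) n) y - dexp_term y (field_deriv u w y) n)" for n
  define K where "K n = (\<Sum>i\<le>n. br (a i) (b (n - i)))" for n
  have RS: "real (Suc n) *\<^sub>R (R (Suc n) - S (Suc n))
      = br (a n) (w y) + br (u y) (b n) - br y (R n - S n)" for n
    unfolding scaleR_diff_right[of _ "R (Suc n)"]
    unfolding R_def S_def a_def b_def dexp_term_derivative[OF u] dexp_term_derivative[OF w]
    by (simp add: br.diff_right br_skew[of "w y"])
  have Ka: "real (Suc n) *\<^sub>R K (Suc n) = br (a n) (w y) + br (u y) (b n) - br y (K n)" for n
  proof -
    have "real (Suc n) *\<^sub>R K (Suc n) =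
        (\<Sum>i\<le>n. br (real (Suc i) *\<^sub>R a (Suc i)) (b (n - i)))
      + (\<Sum>i\<le>n. br (a i) (real (Suc (n - i)) *\<^sub>R b (Suc (n - i))))"
      unfolding K_def by (subst sum_convolution_Suc[of n "\<lambda>i j. br (a i) (b j)"])
        (simp only: br.scaleR_left br.scaleR_right)
    also have "\<dots> = (\<Sum>i\<le>n. br (if i = 0 then u y else 0) (b (n - i)))
      + (\<Sum>i\<le>n. br (a i) (if n - i = 0 then w y else 0))
      - (\<Sum>i\<le>n. br (br y (a i)) (b (n - i)) + br (a i) (br y (b (n - i))))"
      unfolding a_def b_def dexp_term_Suc br.diff_left br.diff_right sum_subtractf sum.distrib by simp
    also have "(\<Sum>i\<le>n. br (if i = 0 then u y else 0) (b (n - i))) =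
        (\<Sum>i\<le>n. if i = 0 then br (u y) (b n) else 0)"
      by (intro sum.cong refl) (simp add: br.zero_left)
    also have "(\<Sum>i\<le>n. br (a i) (if n - i = 0 then w y else 0)) =
        (\<Sum>i\<le>n. if i = n then br (a n) (w y) else 0)"
      by (intro sum.cong refl) (auto simp: br.zero_right)
    finally show ?thesis
      by (simp add: K_def br.sum_right jacobi_derivation[of y])
  qed
  have "R n - S n = K n" for n
  proof (induction n)
    case 0
    show ?case by (simp add: R_def S_def K_def a_def b_def br.zero_left field_deriv_const)
  next
    case (Suc n)
    have "real (Suc n) *\<^sub>R (R (Suc n) - S (Suc n)) = real (Suc n) *\<^sub>R K (Suc n)"
      unfolding RS Ka Suc ..
    then show ?case by (simp del: of_nat_Suc)
  qed
  then have "(\<Sum>n\<le>2*N. R n - S n) = (\<Sum>n\<le>2*N. K n)" by simp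
  also have "\<dots> = (\<Sum>i\<le>N. \<Sum>j\<le>N. br (a i) (b j))"
    unfolding K_def
    by (rule sum_square_diagonals) (auto simp: a_def b_def dexp_term_vanish br.zero_left br.zero_right)
  also have "\<dots> = br (dexp y (u y)) (dexp y (w y))"
    by (subst sum.swap) (simp add: a_def b_def dexp_eq_sum[of N] br.sum_left br.sum_right)
  finally show ?thesis
    unfolding dexp_eq_sum[of "2*N", simplified] R_def S_def
    by (simp add: sum_subtractf field_deriv_sum lie_polynomial_dexp_term u w)
qed

lemma lie_polynomial_inv_field: "lie_polynomial (inv_field a)"
  using lie_poly_inv_field by blast

text \<open>
  Apply the Maurer-Cartan equation to \<open>u = inv_field b\<close> and \<open>w = inv_field a\<close>, for which
  \<open>dexp y (u y)\<close> and \<open>dexp y (w y)\<close> are constant.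
\<close>

lemma inv_field_bracket: "field_deriv (inv_field a) (inv_field b) y - field_deriv (inv_field b) (inv_field a) y = inv_field (br a b) y"
proof -
  have lin: "linear (dexp y)" by (rule linear_nil_eval[OF linear_br])
  have "- (dexp y (field_deriv (inv_field a) (inv_field b) y) - dexp y (field_deriv (inv_field b) (inv_field a) y)) = br b a"
    using dexp_exterior_derivative[OF lie_polynomial_inv_field[of b] lie_polynomial_inv_field[of a], of y]
    by (simp add: dexp_inv_field field_deriv_const)
  then have "dexp y (field_deriv (inv_field a) (inv_field b) y - field_deriv (inv_field b) (inv_field a) y) = br a b"
    unfolding linear_diff[OF lin] br_skew[of a b] by (metis minus_minus)
  then show ?thesis using inv_field_dexp[of y "field_deriv (inv_field a) (inv_field b) y - field_deriv (inv_field b) (inv_field a) y"] by simp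
qed

section \<open>Flows\<close>

text \<open>
  The iterated derivative along the invariant fields of the letters of \<open>l\<close>; the last letter acts first.
\<close>

definition iter_deriv :: "'g list \<Rightarrow> ('g \<Rightarrow> 'g) \<Rightarrow> 'g \<Rightarrow> 'g" where
  "iter_deriv l f = foldr (\<lambda>a. field_deriv (inv_field a)) l f"

lemma iter_deriv_simps [simp]:
  "iter_deriv [] f = f" "iter_deriv (a # l) f = field_deriv (inv_field a) (iter_deriv l f)"
  "iter_deriv (l @ l') f = iter_deriv l (iter_deriv l' f)"
  by (simp_all add: iter_deriv_def)

lemma lie_poly_iter_deriv:
  assumes "lie_poly w m c f"
  shows "\<exists>m' c'. lie_poly (length l + w) m' c' (iter_deriv l f)"
proof (induction l)
  case (Cons a l)
  then show ?case using lie_poly_field_deriv[OF lie_poly_inv_field] by fastforce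
qed (use assms in auto)

lemma lie_polynomial_iter_deriv: "lie_polynomial f \<Longrightarrow> lie_polynomial (iter_deriv l f)"
  using lie_poly_iter_deriv by blast

lemma iter_deriv_vanish:
  assumes "lie_polynomial f" "N < length l" shows "iter_deriv l f = (\<lambda>y. 0)"
proof
  fix y
  obtain w m c where "lie_poly w m c f" using assms by blast
  then obtain m' c' where "lie_poly (length l + w) m' c' (iter_deriv l f)"
    using lie_poly_iter_deriv by blast
  then show "iter_deriv l f y = 0" using assms(2) lie_poly_in_lcs lcs_eq_0[of _ "length l + w"] by simp
qed

lemma iter_deriv_add:
  "lie_polynomial f \<Longrightarrow> lie_polynomial g \<Longrightarrow>
    iter_deriv l (\<lambda>y. f y + g y) = (\<lambda>y. iter_deriv l f y + iter_deriv l g y)"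
  by (induction l) (simp_all add: field_deriv_add lie_polynomial_iter_deriv)

lemma iter_deriv_diff:
  "lie_polynomial f \<Longrightarrow> lie_polynomial g \<Longrightarrow>
    iter_deriv l (\<lambda>y. f y - g y) = (\<lambda>y. iter_deriv l f y - iter_deriv l g y)"
  by (induction l) (simp_all add: field_deriv_diff lie_polynomial_iter_deriv)

lemma iter_deriv_sc:
  "lie_polynomial f \<Longrightarrow> iter_deriv l (\<lambda>y. sc k (f y)) = (\<lambda>y. sc k (iter_deriv l f y))"
  by (induction l) (simp_all add: field_deriv_sc lie_polynomial_iter_deriv)

lemma iter_deriv_bracket:
  assumes "lie_polynomial f"
  shows "iter_deriv (l @ a # b # l') f y - iter_deriv (l @ b # a # l') f y = iter_deriv (l @ br a b # l') f y"
proof -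
  define g where "g = iter_deriv l' f"
  have g: "lie_polynomial g" unfolding g_def by (rule lie_polynomial_iter_deriv[OF assms])
  have p: "lie_polynomial (field_deriv (inv_field a) h)" if "lie_polynomial h" for a h
    using lie_polynomial_iter_deriv[OF that, of "[a]"] by simp
  have "field_deriv (inv_field a) (field_deriv (inv_field b) g) z - field_deriv (inv_field b) (field_deriv (inv_field a) g) z = field_deriv (inv_field (br a b)) g z" for z
    unfolding field_deriv_commutator[OF lie_poly_inv_field lie_poly_inv_field g] inv_field_bracket ..
  then have "iter_deriv l (field_deriv (inv_field (br a b)) g) y
      = iter_deriv l (\<lambda>z. field_deriv (inv_field a) (field_deriv (inv_field b) g) z - field_deriv (inv_field b) (field_deriv (inv_field a) g) z) y"
    by simp
  then show ?thesis by (simp add: iter_deriv_diff p g g_def[symmetric])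
qed

text \<open>
  The coefficient of \<open>t ^ n\<close> in the Taylor series of \<open>f\<close> along the flow of \<open>inv_field b\<close>.
\<close>

definition taylor_coeff :: "'g \<Rightarrow> nat \<Rightarrow> ('g \<Rightarrow> 'g) \<Rightarrow> 'g \<Rightarrow> 'g" where
  "taylor_coeff b n f y = (1 / fact n) *\<^sub>R iter_deriv (replicate n b) f y"

lemma taylor_coeff_0 [simp]: "taylor_coeff b 0 f = f"
  by (simp add: taylor_coeff_def fun_eq_iff)

lemma lie_polynomial_taylor_coeff: "lie_polynomial f \<Longrightarrow> lie_polynomial (taylor_coeff b n f)"
  unfolding taylor_coeff_def[abs_def] by (intro lie_polynomial_scaleR lie_polynomial_iter_deriv)

lemma taylor_coeff_vanish: "lie_polynomial f \<Longrightarrow> N < n \<Longrightarrow> taylor_coeff b n f y = 0"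
  by (simp add: taylor_coeff_def iter_deriv_vanish)

lemma taylor_coeff_Suc:
  assumes "lie_polynomial f"
  shows "real (Suc n) *\<^sub>R taylor_coeff b (Suc n) f y = field_deriv (inv_field b) (taylor_coeff b n f) y"
  unfolding taylor_coeff_def[abs_def] field_deriv_scaleR[OF lie_polynomial_iter_deriv[OF assms]]
  by (simp del: of_nat_Suc)

lemma taylor_coeff_Suc_inner:
  assumes "lie_polynomial f"
  shows "real (Suc n) *\<^sub>R taylor_coeff b (Suc n) f y = taylor_coeff b n (field_deriv (inv_field b) f) y"
  unfolding taylor_coeff_def replicate_Suc replicate_append_same[symmetric]
  by (simp del: of_nat_Suc)

text \<open>
  Leibniz' rule.
\<close>

lemma taylor_coeff_br:
  assumes f: "lie_polynomial f" and g: "lie_polynomial g"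
  shows "taylor_coeff b n (\<lambda>y. br (f y) (g y)) y = (\<Sum>i\<le>n. br (taylor_coeff b i f y) (taylor_coeff b (n - i) g y))"
proof (induction n arbitrary: y)
  case (Suc n)
  have "real (Suc n) *\<^sub>R taylor_coeff b (Suc n) (\<lambda>y. br (f y) (g y)) y
      = field_deriv (inv_field b) (\<lambda>y. \<Sum>i\<le>n. br (taylor_coeff b i f y) (taylor_coeff b (n - i) g y)) y"
    unfolding taylor_coeff_Suc[OF lie_polynomial_br[OF f g]] Suc[abs_def, symmetric] ..
  also have "\<dots> = (\<Sum>i\<le>n. br (field_deriv (inv_field b) (taylor_coeff b i f) y) (taylor_coeff b (n - i) g y))
      + (\<Sum>i\<le>n. br (taylor_coeff b i f y) (field_deriv (inv_field b) (taylor_coeff b (n - i) g) y))"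
    by (simp add: field_deriv_sum field_deriv_br lie_polynomial_br lie_polynomial_taylor_coeff f g sum.distrib)
  also have "\<dots> = real (Suc n) *\<^sub>R (\<Sum>i\<le>Suc n. br (taylor_coeff b i f y) (taylor_coeff b (Suc n - i) g y))"
    by (subst sum_convolution_Suc[of n "\<lambda>i j. br (taylor_coeff b i f y) (taylor_coeff b j g y)"])
      (simp only: taylor_coeff_Suc[OF f, symmetric] taylor_coeff_Suc[OF g, symmetric] br.scaleR_left br.scaleR_right)
  finally show ?case by (simp del: of_nat_Suc sum.atMost_Suc)
qed simp

lemma taylor_coeff_zero: "taylor_coeff b n (\<lambda>y. 0) = (\<lambda>y. 0)"
proof -
  have "iter_deriv l (\<lambda>y. 0) = (\<lambda>y. 0)" for l by (induction l) (simp_all add: field_deriv_const)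
  then show ?thesis by (simp add: taylor_coeff_def fun_eq_iff)
qed

text \<open>
  The flow of \<open>inv_field b\<close>, defined by its Taylor series, which is finite by \<open>taylor_coeff_vanish\<close>.
\<close>

definition flow :: "'g \<Rightarrow> real \<Rightarrow> 'g \<Rightarrow> 'g" where
  "flow b t x = (\<Sum>n\<le>N. t ^ n *\<^sub>R taylor_coeff b n (\<lambda>y. y) x)"

text \<open>
  The exponential of a derivation is an automorphism, so both sides respect brackets in \<open>f\<close>; for the
  identity the claim is the definition of the flow.
\<close>

lemma taylor_flow:
  assumes "lie_polynomial f"
  shows "f (flow b t x) = (\<Sum>n\<le>N. t ^ n *\<^sub>R taylor_coeff b n f x)"
proof -
  obtain w m c where "lie_poly w m c f" using assms by blast
  then show ?thesis
  proof (induction rule: lie_poly.induct)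
    case ident
    show ?case by (simp add: flow_def)
  next
    case (const a)
    have "taylor_coeff b (Suc n) (\<lambda>y. a) x = 0" for n
      using taylor_coeff_Suc_inner[OF lie_polynomial_const[of a], of n b x]
      by (simp add: field_deriv_const taylor_coeff_zero del: of_nat_Suc)
    then show ?case by (simp add: sum.atMost_shift)
  next
    case (zero w m)
    then show ?case by (simp add: taylor_coeff_zero)
  next
    case (brack w m c f w' m' c' g)
    then have fg: "lie_polynomial f" "lie_polynomial g" by blast+
    have "br (f (flow b t x)) (g (flow b t x)) =
        (\<Sum>i\<le>N. \<Sum>j\<le>N. t ^ (i + j) *\<^sub>R br (taylor_coeff b i f x) (taylor_coeff b j g x))"
      by (subst sum.swap)
        (simp add: brack.IH br.sum_left br.sum_right br.scaleR_left br.scaleR_right power_add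
          scaleR_sum_right mult.commute)
    also have "\<dots> = (\<Sum>n\<le>2*N. \<Sum>i\<le>n. t ^ (i + (n - i)) *\<^sub>R br (taylor_coeff b i f x) (taylor_coeff b (n - i) g x))"
      by (rule sum_square_diagonals[symmetric])
        (auto simp: taylor_coeff_vanish fg br.zero_left br.zero_right)
    also have "\<dots> = (\<Sum>n\<le>2*N. t ^ n *\<^sub>R taylor_coeff b n (\<lambda>y. br (f y) (g y)) x)"
      by (intro sum.cong refl) (simp add: taylor_coeff_br fg scaleR_sum_right)
    also have "\<dots> = (\<Sum>n\<le>N. t ^ n *\<^sub>R taylor_coeff b n (\<lambda>y. br (f y) (g y)) x)"
      by (rule sum.mono_neutral_right) (auto simp: taylor_coeff_vanish lie_polynomial_br fg)
    finally show ?case .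
  next
    case (add w m c f c' g)
    then have fg: "lie_polynomial f" "lie_polynomial g" by blast+
    show ?case
      by (simp add: add.IH taylor_coeff_def iter_deriv_add fg scaleR_right_distrib sum.distrib)
  next
    case (scale w m c f k)
    then have f: "lie_polynomial f" by blast
    show ?case
      by (simp add: scale.IH taylor_coeff_def iter_deriv_sc f sc_sum_right sc_scaleR)
  qed
qed

lemma flow_0: "flow b 0 x = x"
  by (simp add: flow_def sum.atMost_shift)

lemma flow_derivative: "((\<lambda>t. flow b t x) has_vector_derivative inv_field b (flow b t x)) (at t)"
proof -
  have "((\<lambda>t. flow b t x) has_vector_derivative
      (\<Sum>n\<le>N. (real n * t ^ (n - 1)) *\<^sub>R taylor_coeff b n (\<lambda>y. y) x)) (at t)"
    unfolding flow_def
    by (auto intro!: derivative_eq_intros simp: sum_distrib_right)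
  moreover have "(\<Sum>n\<le>N. (real n * t ^ (n - 1)) *\<^sub>R taylor_coeff b n (\<lambda>y. y) x) = inv_field b (flow b t x)"
  proof -
    have "(\<Sum>n\<le>N. (real n * t ^ (n - 1)) *\<^sub>R taylor_coeff b n (\<lambda>y. y) x)
        = (\<Sum>n\<le>Suc N. (real n * t ^ (n - 1)) *\<^sub>R taylor_coeff b n (\<lambda>y. y) x)"
      by (simp add: taylor_coeff_vanish lie_polynomial_ident)
    also have "\<dots> = (\<Sum>n\<le>N. t ^ n *\<^sub>R (real (Suc n) *\<^sub>R taylor_coeff b (Suc n) (\<lambda>y. y) x))"
      by (subst sum.atMost_Suc_shift) (simp add: mult.commute del: of_nat_Suc)
    also have "\<dots> = (\<Sum>n\<le>N. t ^ n *\<^sub>R taylor_coeff b n (inv_field b) x)"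
      by (simp only: taylor_coeff_Suc_inner[OF lie_polynomial_ident] field_deriv_ident)
    also have "\<dots> = inv_field b (flow b t x)" by (rule taylor_flow[OF lie_polynomial_inv_field, symmetric])
    finally show ?thesis .
  qed
  ultimately show ?thesis by simp
qed

section \<open>Multilinear forms on the truncated enveloping algebra\<close>

text \<open>
  Bounded linear maps into the algebra from its enveloping algebra modulo products of more than \<open>d\<close>
  elements, as functions on words: multilinearity over the scalar field, the defining relations of the
  enveloping algebra, vanishing on words longer than \<open>d\<close>, and boundedness on words in the unit ball.
\<close>

definition word_form :: "nat \<Rightarrow> ('g list \<Rightarrow> 'g) \<Rightarrow> bool" where
  "word_form d f \<longleftrightarrow>
     (\<forall>l l' x y. f (l @ (x + y) # l') = f (l @ x # l') + f (l @ y # l')) \<and>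
     (\<forall>l l' c x. f (l @ sc c x # l') = sc c (f (l @ x # l'))) \<and>
     (\<forall>l l' a b. f (l @ a # b # l') - f (l @ b # a # l') = f (l @ br a b # l')) \<and>
     (\<forall>l. d < length l \<longrightarrow> f l = 0) \<and>
     (\<exists>C. \<forall>l. (\<forall>x\<in>set l. norm x \<le> 1) \<longrightarrow> norm (f l) \<le> C)"

lemma word_formI:
  assumes "\<And>l l' x y. f (l @ (x + y) # l') = f (l @ x # l') + f (l @ y # l')"
    and "\<And>l l' c x. f (l @ sc c x # l') = sc c (f (l @ x # l'))"
    and "\<And>l l' a b. f (l @ a # b # l') - f (l @ b # a # l') = f (l @ br a b # l')"
    and "\<And>l. d < length l \<Longrightarrow> f l = 0"
    and "\<And>l. (\<And>x. x \<in> set l \<Longrightarrow> norm x \<le> 1) \<Longrightarrow> norm (f l) \<le> C"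
  shows "word_form d f"
  unfolding word_form_def using assms by (intro conjI allI impI exI[of _ C]) simp_all

lemma
  assumes "word_form d f"
  shows word_form_add: "f (l @ (x + y) # l') = f (l @ x # l') + f (l @ y # l')"
    and word_form_sc: "f (l @ sc c x # l') = sc c (f (l @ x # l'))"
    and word_form_br: "f (l @ a # b # l') - f (l @ b # a # l') = f (l @ br a b # l')"
    and word_form_vanish: "d < length l \<Longrightarrow> f l = 0"
  using assms unfolding word_form_def by simp_all

lemma word_form_scaleR: "word_form d f \<Longrightarrow> f (l @ (r *\<^sub>R x) # l') = r *\<^sub>R f (l @ x # l')"
  using word_form_sc[of d f l "of_real r" x l'] by (simp add: sc_of_real)

lemma word_form_linear: "word_form d f \<Longrightarrow> linear (\<lambda>x. f (l @ x # l'))"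
  by (rule linearI) (simp_all add: word_form_add word_form_scaleR)

lemma word_form_bound:
  assumes f: "word_form d f" and C: "\<And>l. (\<And>x. x \<in> set l \<Longrightarrow> norm x \<le> 1) \<Longrightarrow> norm (f l) \<le> C"
  shows "norm (f l) \<le> C * prod_list (map norm l)"
proof -
  define u :: "'g \<Rightarrow> 'g" where "u x = (1 / norm x) *\<^sub>R x" for x
  have "f (l' @ l) = prod_list (map norm l) *\<^sub>R f (l' @ map u l)" for l'
  proof (induction l arbitrary: l')
    case (Cons x l)
    have "f (l' @ x # l) = f (l' @ (norm x *\<^sub>R u x) # l)" by (simp add: u_def)
    also have "\<dots> = norm x *\<^sub>R f ((l' @ [u x]) @ l)" by (simp add: word_form_scaleR[OF f])
    also have "\<dots> = prod_list (map norm (x # l)) *\<^sub>R f (l' @ map u (x # l))"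
      by (subst Cons.IH) simp
    finally show ?case .
  qed simp
  from this[of "[]"] have "f l = prod_list (map norm l) *\<^sub>R f (map u l)" by simp
  moreover have "norm (f (map u l)) \<le> C" by (rule C) (auto simp: u_def)
  moreover have p: "0 \<le> prod_list (map norm l)" by (induction l) auto
  ultimately show ?thesis by (simp add: mult.commute[of C] mult_left_mono)
qed

lemma word_form_bounded:
  assumes "word_form d f"
  obtains C where "C \<ge> 0" "\<And>l. norm (f l) \<le> C * prod_list (map norm l)"
proof -
  obtain C where C: "\<forall>l. (\<forall>x\<in>set l. norm x \<le> 1) \<longrightarrow> norm (f l) \<le> C"
    using assms by (auto simp: word_form_def)
  have "norm (f []) \<le> C" using C by simp
  then have "C \<ge> 0" by (rule order_trans[OF norm_ge_zero])
  moreover have "norm (f l) \<le> C * prod_list (map norm l)" for l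
    by (rule word_form_bound[OF assms]) (use C in simp)
  ultimately show thesis by (rule that)
qed

lemma word_form_bounded_linear:
  assumes "word_form d f" shows "bounded_linear (\<lambda>x. f (l @ x # l'))"
proof -
  obtain C where C: "\<And>l. norm (f l) \<le> C * prod_list (map norm l)"
    using word_form_bounded[OF assms] by blast
  show ?thesis
    by (rule bounded_linear_intro[where K = "C * prod_list (map norm l) * prod_list (map norm l')"])
      (use C[of "l @ _ # l'"] in \<open>simp_all add: word_form_add[OF assms] word_form_scaleR[OF assms] mult_ac\<close>)
qed

lemma word_form_mono: "word_form d f \<Longrightarrow> d \<le> d' \<Longrightarrow> word_form d' f"
  unfolding word_form_def by (meson le_less_trans)

lemma word_form_zero: "word_form d (\<lambda>l. 0)"
  by (rule word_formI[where C = 0]) auto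

lemma word_form_plus:
  assumes f: "word_form d f" and g: "word_form d g"
  shows "word_form d (\<lambda>l. f l + g l)"
proof -
  obtain C where "\<forall>l. (\<forall>x\<in>set l. norm x \<le> 1) \<longrightarrow> norm (f l) \<le> C"
    using f by (auto simp: word_form_def)
  moreover obtain D where "\<forall>l. (\<forall>x\<in>set l. norm x \<le> 1) \<longrightarrow> norm (g l) \<le> D"
    using g by (auto simp: word_form_def)
  ultimately show ?thesis
    by (intro word_formI[where C = "C + D"])
      (auto simp: word_form_add[OF f] word_form_add[OF g] word_form_sc[OF f] word_form_sc[OF g]
        word_form_br[OF f, symmetric] word_form_br[OF g, symmetric] word_form_vanish[OF f]
        word_form_vanish[OF g] sc_add_right intro!: norm_triangle_mono)
qed

lemma word_form_scale:
  assumes f: "word_form d f"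
  shows "word_form d (\<lambda>l. sc c (f l))"
proof -
  obtain C where "\<forall>l. (\<forall>x\<in>set l. norm x \<le> 1) \<longrightarrow> norm (f l) \<le> C"
    using f by (auto simp: word_form_def)
  then show ?thesis
    by (intro word_formI[where C = "norm c * C"])
      (auto simp: word_form_add[OF f] word_form_sc[OF f] word_form_br[OF f, symmetric]
        word_form_vanish[OF f] sc_add_right sc_diff_right sc_mult norm_sc mult.commute[of c] mult_left_mono)
qed

lemma word_form_scaleR_form: "word_form d f \<Longrightarrow> word_form d (\<lambda>l. r *\<^sub>R f l)"
  using word_form_scale[of d f "of_real r"] by (simp add: sc_of_real)

lemma word_form_sum:
  assumes "finite A" "\<And>i. i \<in> A \<Longrightarrow> word_form d (f i)"
  shows "word_form d (\<lambda>l. \<Sum>i\<in>A. f i l)"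
  using assms by (induction rule: finite_induct) (auto intro: word_form_zero word_form_plus)

lemma word_form_append:
  assumes f: "word_form d f"
  shows "word_form (d - length m) (\<lambda>l. f (l @ m))"
proof -
  obtain C where C: "C \<ge> 0" "\<And>l. norm (f l) \<le> C * prod_list (map norm l)"
    using word_form_bounded[OF f] by blast
  show ?thesis
  proof (rule word_formI[where C = "C * prod_list (map norm m)"])
    fix l :: "'g list" assume l: "\<And>x. x \<in> set l \<Longrightarrow> norm x \<le> 1"
    then have "prod_list (map norm l) \<le> 1"
      by (induction l) (auto intro!: mult_le_one prod_list_nonneg)
    then have "prod_list (map norm l) * prod_list (map norm m) \<le> 1 * prod_list (map norm m)"
      by (intro mult_right_mono prod_list_nonneg) auto
    then show "norm (f (l @ m)) \<le> C * prod_list (map norm m)"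
      using order_trans[OF C(2)[of "l @ m"]] mult_left_mono[OF _ C(1)] by simp
  qed (simp_all add: word_form_add[OF f] word_form_sc[OF f] word_form_br[OF f] word_form_vanish[OF f])
qed

lemma word_form_shift: "word_form (Suc d) f \<Longrightarrow> word_form d (\<lambda>l. f (l @ [y]))"
  using word_form_append[of "Suc d" f "[y]"] by simp

text \<open>
  The letters are exchanged one at a time.
\<close>

lemma word_form_power_Lipschitz:
  assumes f: "word_form d f" and C: "\<And>l. norm (f l) \<le> C * prod_list (map norm l)"
    and M: "norm a \<le> M" "norm b \<le> M" "1 \<le> M"
  shows "norm (f (l @ replicate n a @ l') - f (l @ replicate n b @ l'))
    \<le> C * prod_list (map norm l) * prod_list (map norm l') * (real n * M ^ n) * norm (a - b)"
proof (induction n arbitrary: l)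
  case (Suc n)
  define P where "P l = prod_list (map norm l)" for l :: "'g list"
  have "norm (f []) \<le> C" using C[of "[]"] by simp
  then have C0: "C \<ge> 0" by (rule order_trans[OF norm_ge_zero])
  have P0: "P l \<ge> 0" for l unfolding P_def by (rule prod_list_nonneg) auto
  have Pr: "P (replicate n a) = norm a ^ n" by (induction n) (simp_all add: P_def)
  have "f (l @ replicate (Suc n) a @ l') - f (l @ replicate (Suc n) b @ l') =
      f (l @ (a - b) # replicate n a @ l')
      + (f ((l @ [b]) @ replicate n a @ l') - f ((l @ [b]) @ replicate n b @ l'))"
    using linear_diff[OF word_form_linear[OF f], of l a b] by simp
  then have "norm (f (l @ replicate (Suc n) a @ l') - f (l @ replicate (Suc n) b @ l'))
      \<le> C * P (l @ (a - b) # replicate n a @ l')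
        + C * P (l @ [b]) * P l' * (real n * M ^ n) * norm (a - b)"
    using Suc.IH[of "l @ [b]"] C[of "l @ (a - b) # replicate n a @ l'"]
    unfolding P_def by (smt (verit) norm_triangle_ineq)
  also have "\<dots> = C * P l * P l' * norm (a - b) * (norm a ^ n)
      + C * P l * P l' * norm (a - b) * (norm b * (real n * M ^ n))"
    using Pr by (simp add: P_def mult_ac)
  also have "\<dots> \<le> C * P l * P l' * norm (a - b) * (M * M ^ n)
      + C * P l * P l' * norm (a - b) * (M * (real n * M ^ n))"
  proof (intro add_mono mult_left_mono mult_right_mono mult_nonneg_nonneg C0 P0)
    have "norm a ^ n \<le> 1 * M ^ n" using M by (simp add: power_mono)
    also have "\<dots> \<le> M * M ^ n" using M by (intro mult_right_mono) auto
    finally show "norm a ^ n \<le> M * M ^ n" .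
  qed (use M in auto)
  finally show ?case by (simp add: P_def algebra_simps)
qed simp

lemma replicate_before_end: "i < n \<Longrightarrow> replicate (n - 1 - i) b @ b # l = replicate (n - i) b @ l"
proof -
  assume "i < n"
  then obtain k where "n = Suc (i + k)" using less_iff_Suc_add by blast
  then show ?thesis by (simp add: replicate_app_Cons_same)
qed

lemma word_form_power_derivative:
  assumes f: "word_form d f"
  shows "((\<lambda>z. f (l @ replicate n z @ l')) has_derivative
    (\<lambda>h. \<Sum>i<n. f (l @ replicate i b @ h # replicate (n - 1 - i) b @ l'))) (at b)"
proof (induction n arbitrary: l')
  case (Suc n)
  obtain C where C: "C \<ge> 0" "\<And>l. norm (f l) \<le> C * prod_list (map norm l)"
    using word_form_bounded[OF f] by blast
  \<comment> \<open>split off the last letter: \<open>z = b + (z - b)\<close>; the remainder \<open>r\<close> is of second order at \<open>b\<close>\<close>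
  define r where "r z = f (l @ replicate n z @ (z - b) # l') - f (l @ replicate n b @ (z - b) # l')" for z
  define M where "M = norm b + 1"
  define K where "K = C * prod_list (map norm l) * prod_list (map norm l') * (real n * M ^ n)"
  have r: "norm (r z) \<le> K * norm (z - b) * norm (z - b)" if "norm (z - b) < 1" for z
  proof -
    have "norm z \<le> M" using that norm_triangle_sub[of z b] by (simp add: M_def)
    then show ?thesis
      using word_form_power_Lipschitz[OF f C(2), of z M b l n "(z - b) # l'"]
      by (simp add: r_def K_def M_def mult_ac)
  qed
  have "(r has_derivative (\<lambda>h. 0)) (at b)"
  proof (rule has_derivativeI)
    have "((\<lambda>z. K * norm (z - b)) \<longlongrightarrow> K * norm (b - b)) (at b)"
      by (intro tendsto_intros)
    then have K: "((\<lambda>z. K * norm (z - b)) \<longlongrightarrow> 0) (at b)" by simp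
    show "((\<lambda>z. (r z - r b - 0) /\<^sub>R norm (z - b)) \<longlongrightarrow> 0) (at b)"
    proof (rule Lim_null_comparison[OF _ K])
      have "\<forall>\<^sub>F z in at b. dist z b < 1 \<and> z \<noteq> b"
        by (auto simp: eventually_at intro: exI[of _ 1])
      then show "\<forall>\<^sub>F z in at b. norm ((r z - r b - 0) /\<^sub>R norm (z - b)) \<le> K * norm (z - b)"
      proof eventually_elim
        case (elim z)
        have "r b = 0" by (simp add: r_def)
        then show ?case using r[of z] elim by (simp add: dist_norm field_simps)
      qed
    qed
  qed simp
  moreover have "((\<lambda>z. f (l @ replicate n b @ (z - b) # l')) has_derivative
      (\<lambda>h. f (l @ replicate n b @ h # l'))) (at b)"
  proof -
    have "((\<lambda>z. z - b) has_derivative (\<lambda>h. h)) (at b)"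
      by (auto intro!: derivative_eq_intros)
    from bounded_linear.has_derivative[OF word_form_bounded_linear[OF f, of "l @ replicate n b" l'] this]
    show ?thesis by simp
  qed
  ultimately have "((\<lambda>z. r z + f (l @ replicate n b @ (z - b) # l') + f (l @ replicate n z @ b # l'))
      has_derivative (\<lambda>h. 0 + f (l @ replicate n b @ h # l')
        + (\<Sum>i<n. f (l @ replicate i b @ h # replicate (n - 1 - i) b @ b # l')))) (at b)"
    by (intro has_derivative_add Suc.IH)
  moreover have "r z + f (l @ replicate n b @ (z - b) # l') + f (l @ replicate n z @ b # l')
      = f (l @ replicate (Suc n) z @ l')" for z
    using linear_diff[OF word_form_linear[OF f], of "l @ replicate n z" z b l']
    by (simp add: r_def replicate_app_Cons_same)
  moreover have "(\<Sum>i<n. f (l @ replicate i b @ h # replicate (n - 1 - i) b @ b # l'))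
      = (\<Sum>i<n. f (l @ replicate i b @ h # replicate (n - i) b @ l'))" for h
  proof (intro sum.cong refl)
    fix i assume "i \<in> {..<n}"
    then have "replicate (n - 1 - i) b @ b # l' = replicate (n - i) b @ l'"
      by (intro replicate_before_end) simp
    then show "f (l @ replicate i b @ h # replicate (n - 1 - i) b @ b # l')
      = f (l @ replicate i b @ h # replicate (n - i) b @ l')" by (simp only:)
  qed
  ultimately show ?case by (simp add: add.commute)
qed simp

text \<open>
  The derivative of the exponential, in degree \<open>n\<close>: the derivative of \<open>exp b\<close> in direction \<open>h\<close> is
  \<open>exp b\<close> times \<open>dexp b h\<close>. Both sides satisfy \<open>(n + 1) c\<^bsub>n + 1\<^esub> = b ^ n h / n! + c\<^sub>n b\<close> as elements of
  the enveloping algebra, and the trailing factor \<open>b\<close> is absorbed in the arbitrary suffix \<open>l'\<close>.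
\<close>

lemma word_form_dexp_term:
  assumes f: "word_form d f"
  shows "(1 / fact n) *\<^sub>R (\<Sum>i<n. f (l @ replicate i b @ h # replicate (n - 1 - i) b @ l')) =
    (\<Sum>i\<le>n. (1 / fact i) *\<^sub>R f (l @ replicate i b @ dexp_term b h (n - i) # l'))"
proof (induction n arbitrary: l')
  case 0
  show ?case using linear_0[OF word_form_linear[OF f]] by simp
next
  case (Suc n)
  let ?F = "dexp_term b h"
  define g where "g l' i j = (1 / fact i) *\<^sub>R f (l @ replicate i b @ ?F j # l')" for l' i j
  have lin: "linear (\<lambda>x. f (l @ replicate i b @ x # l'))" for i
    using word_form_linear[OF f, of "l @ replicate i b" l'] by simp
  have up: "real (Suc i) *\<^sub>R g l' (Suc i) j = (1 / fact i) *\<^sub>R f (l @ replicate i b @ b # ?F j # l')" for i j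
    by (simp add: g_def replicate_app_Cons_same del: of_nat_Suc)
  have right: "real (Suc j) *\<^sub>R g l' i (Suc j)
      = (if j = 0 then (1 / fact i) *\<^sub>R f (l @ replicate i b @ h # l') else 0)
      - (1 / fact i) *\<^sub>R f (l @ replicate i b @ br b (?F j) # l')" for i j
  proof -
    have "real (Suc j) *\<^sub>R g l' i (Suc j) =
        (1 / fact i) *\<^sub>R f (l @ replicate i b @ (real (Suc j) *\<^sub>R ?F (Suc j)) # l')"
      unfolding g_def linear_scale[OF lin] by (simp add: mult.commute)
    then show ?thesis
      unfolding dexp_term_Suc linear_diff[OF lin] using linear_0[OF lin] by (simp add: scaleR_diff_right)
  qed
  have comm: "(1 / fact i) *\<^sub>R f (l @ replicate i b @ b # ?F j # l')
      - (1 / fact i) *\<^sub>R f (l @ replicate i b @ br b (?F j) # l') = g (b # l') i j" for i j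
    using word_form_br[OF f, of "l @ replicate i b" b "?F j" l', symmetric]
    by (simp add: g_def scaleR_diff_right)
  have "real (Suc n) *\<^sub>R (\<Sum>i\<le>Suc n. g l' i (Suc n - i)) =
      (\<Sum>i\<le>n. (1 / fact i) *\<^sub>R f (l @ replicate i b @ b # ?F (n - i) # l'))
    + ((\<Sum>i\<le>n. if n - i = 0 then (1 / fact i) *\<^sub>R f (l @ replicate i b @ h # l') else 0)
    - (\<Sum>i\<le>n. (1 / fact i) *\<^sub>R f (l @ replicate i b @ br b (?F (n - i)) # l')))"
    by (subst sum_convolution_Suc) (simp only: up right sum_subtractf)
  also have "(\<Sum>i\<le>n. if n - i = 0 then (1 / fact i) *\<^sub>R f (l @ replicate i b @ h # l') else 0)
      = (\<Sum>i\<le>n. if i = n then (1 / fact n) *\<^sub>R f (l @ replicate n b @ h # l') else 0)"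
    by (intro sum.cong refl) auto
  also have "(\<Sum>i\<le>n. (1 / fact i) *\<^sub>R f (l @ replicate i b @ b # ?F (n - i) # l'))
    + ((\<Sum>i\<le>n. if i = n then (1 / fact n) *\<^sub>R f (l @ replicate n b @ h # l') else 0)
    - (\<Sum>i\<le>n. (1 / fact i) *\<^sub>R f (l @ replicate i b @ br b (?F (n - i)) # l')))
    = (1 / fact n) *\<^sub>R f (l @ replicate n b @ h # l') + (\<Sum>i\<le>n. g (b # l') i (n - i))"
    unfolding comm[symmetric] sum_subtractf by simp
  also have "(\<Sum>i\<le>n. g (b # l') i (n - i))
      = (1 / fact n) *\<^sub>R (\<Sum>i<n. f (l @ replicate i b @ h # replicate (n - 1 - i) b @ b # l'))"
    unfolding g_def Suc.IH ..
  also have "(\<Sum>i<n. f (l @ replicate i b @ h # replicate (n - 1 - i) b @ b # l'))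
      = (\<Sum>i<n. f (l @ replicate i b @ h # replicate (n - i) b @ l'))"
  proof (intro sum.cong refl)
    fix i assume "i \<in> {..<n}"
    then have "replicate (n - 1 - i) b @ b # l' = replicate (n - i) b @ l'"
      by (intro replicate_before_end) simp
    then show "f (l @ replicate i b @ h # replicate (n - 1 - i) b @ b # l')
      = f (l @ replicate i b @ h # replicate (n - i) b @ l')" by (simp only:)
  qed
  also have "(1 / fact n) *\<^sub>R f (l @ replicate n b @ h # l') + (1 / fact n) *\<^sub>R \<dots>
      = real (Suc n) *\<^sub>R ((1 / fact (Suc n)) *\<^sub>R
        (\<Sum>i<Suc n. f (l @ replicate i b @ h # replicate (Suc n - 1 - i) b @ l')))"
    by (simp add: scaleR_right_distrib del: of_nat_Suc)
  finally show ?case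
    by (simp only: g_def scaleR_cancel_left of_nat_eq_0_iff nat.distinct simp_thms)
qed

text \<open>
  The exponential of the operator that appends the letter \<open>x\<close>. The sum is complete for forms
  that vanish on words longer than \<open>N\<close>.
\<close>

definition exp_act :: "'g \<Rightarrow> ('g list \<Rightarrow> 'g) \<Rightarrow> 'g list \<Rightarrow> 'g" where
  "exp_act x f l = (\<Sum>n\<le>N. (1 / fact n) *\<^sub>R f (l @ replicate n x))"

lemma exp_act_derivative:
  assumes f: "word_form d f" and d: "d \<le> N" and z: "(z has_vector_derivative z') (at t)"
  shows "((\<lambda>t. exp_act (z t) f l) has_vector_derivative
    exp_act (z t) (\<lambda>l. f (l @ [dexp (z t) z'])) l) (at t)"
proof -
  let ?D = "\<lambda>n h. \<Sum>i<n. f (l @ replicate i (z t) @ h # replicate (n - 1 - i) (z t) @ [])"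
  define g where "g i j = (1 / fact i) *\<^sub>R f (l @ replicate i (z t) @ [dexp_term (z t) z' j])" for i j
  have "((\<lambda>t. f (l @ replicate n (z t) @ [])) has_vector_derivative ?D n z') (at t)" for n
  proof -
    have lin: "linear (?D n)"
      using word_form_power_derivative[OF f] has_derivative_linear by blast
    have "((\<lambda>t. f (l @ replicate n (z t) @ [])) has_derivative (\<lambda>s. ?D n (s *\<^sub>R z'))) (at t)"
      using diff_chain_at[OF z[unfolded has_vector_derivative_def] word_form_power_derivative[OF f, of l n "[]"]]
      by (simp add: o_def)
    then show ?thesis unfolding has_vector_derivative_def linear_scale[OF lin] .
  qed
  then have "((\<lambda>t. exp_act (z t) f l) has_vector_derivative (\<Sum>n\<le>N. (1 / fact n) *\<^sub>R ?D n z')) (at t)"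
    unfolding exp_act_def
    by (intro has_vector_derivative_sum bounded_linear.has_vector_derivative[OF bounded_linear_scaleR_right])
      simp
  also have "(\<Sum>n\<le>N. (1 / fact n) *\<^sub>R ?D n z') = (\<Sum>n\<le>2*N. (1 / fact n) *\<^sub>R ?D n z')"
    using d by (intro sum.mono_neutral_left) (auto intro!: sum.neutral word_form_vanish[OF f])
  also have "\<dots> = (\<Sum>n\<le>2*N. \<Sum>i\<le>n. g i (n - i))"
    unfolding g_def word_form_dexp_term[OF f] ..
  also have "\<dots> = (\<Sum>i\<le>N. \<Sum>j\<le>N. g i j)"
    using d linear_0[OF word_form_linear[OF f, of "l @ replicate _ (z t)" "[]"]]
    by (intro sum_square_diagonals) (auto simp: g_def dexp_term_vanish word_form_vanish[OF f])
  also have "\<dots> = exp_act (z t) (\<lambda>l. f (l @ [dexp (z t) z'])) l"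
  proof -
    have "f (l @ replicate i (z t) @ [\<Sum>j\<le>N. dexp_term (z t) z' j])
        = (\<Sum>j\<le>N. f (l @ replicate i (z t) @ [dexp_term (z t) z' j]))" for i
      using linear_sum[OF word_form_linear[OF f, of "l @ replicate i (z t)" "[]"]] by simp
    then show ?thesis by (simp add: exp_act_def dexp_eq_sum[of N] g_def scaleR_sum_right)
  qed
  finally show ?thesis .
qed

lemma word_form_exp_act: "word_form d f \<Longrightarrow> word_form d (exp_act x f)"
  unfolding exp_act_def[abs_def]
  by (intro word_form_sum word_form_scaleR_form word_form_mono[OF word_form_append]) auto

lemma exp_act_0:
  assumes "word_form d f" shows "exp_act 0 f l = f l"
proof -
  have "f (l @ 0 # l') = 0" for l' using linear_0[OF word_form_linear[OF assms]] .
  then show ?thesis by (simp add: exp_act_def sum.atMost_shift)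
qed

lemma dexp_commuting: "br y u = 0 \<Longrightarrow> dexp y u = u"
proof -
  assume 0: "br y u = 0"
  have "(br y ^^ Suc n) u = 0" for n by (simp add: funpow_swap1 0)
  then show ?thesis by (simp add: nil_eval_def sum.atMost_shift dexp_fps_def del: funpow.simps)
qed

text \<open>
  Differentiating either side in \<open>t\<close> replaces \<open>f\<close> by \<open>l \<mapsto> f (l y)\<close>, which vanishes on shorter words. So
  induction on \<open>d\<close> shows that the difference of the two sides is constant.
\<close>

lemma exp_act_flow:
  assumes "word_form d f" "d \<le> N"
  shows "exp_act (flow y t x) f l = exp_act x (exp_act (t *\<^sub>R y) f) l"
  using assms
proof (induction d arbitrary: f l t)
  case 0
  have "f (l @ a # l') = 0" for l a l' using word_form_vanish[OF 0(1)] by simp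
  then show ?case by (simp add: exp_act_def sum.atMost_shift)
next
  case (Suc d)
  let ?\<delta> = "\<lambda>t. exp_act (flow y t x) f l - exp_act x (exp_act (t *\<^sub>R y) f) l"
  have "(?\<delta> has_vector_derivative 0) (at t)" for t
  proof -
    let ?f' = "\<lambda>l. f (l @ [y])"
    have "((\<lambda>t. exp_act (flow y t x) f l) has_vector_derivative exp_act (flow y t x) ?f' l) (at t)"
      using exp_act_derivative[OF Suc.prems flow_derivative] by (simp add: dexp_inv_field)
    moreover have "((\<lambda>t. exp_act x (exp_act (t *\<^sub>R y) f) l) has_vector_derivative
        exp_act x (exp_act (t *\<^sub>R y) ?f') l) (at t)"
      unfolding exp_act_def[of x]
    proof (intro has_vector_derivative_sum bounded_linear.has_vector_derivative[OF bounded_linear_scaleR_right])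
      fix n
      have "((\<lambda>t. t *\<^sub>R y) has_vector_derivative y) (at t)"
        by (auto intro!: derivative_eq_intros)
      from exp_act_derivative[OF Suc.prems this]
      show "((\<lambda>t. exp_act (t *\<^sub>R y) f (l @ replicate n x)) has_vector_derivative
          exp_act (t *\<^sub>R y) ?f' (l @ replicate n x)) (at t)"
        by (simp add: dexp_commuting br_scaleR_left alternating)
    qed
    ultimately have "(?\<delta> has_vector_derivative
        exp_act (flow y t x) ?f' l - exp_act x (exp_act (t *\<^sub>R y) ?f') l) (at t)"
      by (rule has_vector_derivative_diff)
    moreover have "exp_act (flow y t x) ?f' l = exp_act x (exp_act (t *\<^sub>R y) ?f') l"
      by (rule Suc.IH) (use Suc.prems in \<open>auto intro: word_form_shift\<close>)
    ultimately show ?thesis by simp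
  qed
  then have "?\<delta> t = ?\<delta> 0"
    by (intro has_derivative_zero_unique[of UNIV]) (auto simp: has_vector_derivative_def)
  also have "\<dots> = 0" by (simp add: flow_0 exp_act_0[OF Suc.prems(1)] exp_act_def[of x])
  finally show ?case by simp
qed

section \<open>Dynkin's formula\<close>

text \<open>
  The adjoint representation applied to a fixed vector, as a form on words.
\<close>

definition ad_form :: "'g \<Rightarrow> 'g list \<Rightarrow> 'g" where
  "ad_form w l = foldr br l w"

lemma ad_form_append: "ad_form w (l @ m) = ad_form (ad_form w m) l"
  by (simp add: ad_form_def)

lemma ad_form_replicate: "ad_form w (replicate n x) = (br x ^^ n) w"
  by (induction n) (simp_all add: ad_form_def)

lemma linear_ad_form: "linear (\<lambda>w. ad_form w l)"
proof (induction l)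
  case Nil
  show ?case using linear_id by (simp add: ad_form_def id_def)
next
  case (Cons a l)
  then show ?case using linear_compose[OF Cons linear_br[of a]] by (simp add: ad_form_def o_def)
qed

lemma ad_form_sc: "ad_form (sc k w) l = sc k (ad_form w l)"
  by (induction l) (simp_all add: ad_form_def br_sc_right)

lemma ad_form_in_lcs: "ad_form w l \<in> lcs sc br (length l)"
  by (induction l) (auto simp: ad_form_def intro: lcs_br_Suc)

lemma word_form_ad_form: "word_form N (ad_form w)"
proof -
  obtain K0 where K0: "K0 > 0" "\<And>x y. norm (br x y) \<le> norm x * norm y * K0"
    using br.pos_bounded by blast
  define K where "K = max 1 K0"
  have K: "K \<ge> 1" "K0 \<le> K" by (simp_all add: K_def)
  have bound: "norm (ad_form w l) \<le> K ^ length l * norm w" if "\<And>x. x \<in> set l \<Longrightarrow> norm x \<le> 1" for l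
    using that
  proof (induction l)
    case (Cons a l)
    have "norm (br a (ad_form w l)) \<le> norm a * norm (ad_form w l) * K0" by (rule K0)
    also have "\<dots> \<le> 1 * (K ^ length l * norm w) * K"
      using Cons K K0(1) by (intro mult_mono) auto
    finally show ?case by (simp add: ad_form_def mult_ac)
  qed (simp add: ad_form_def)
  have van: "ad_form w l = 0" if "N < length l" for l
    using ad_form_in_lcs that by (rule lcs_eq_0)
  show ?thesis
  proof (rule word_formI[where C = "K ^ N * norm w"])
    fix l l' x y
    show "ad_form w (l @ (x + y) # l') = ad_form w (l @ x # l') + ad_form w (l @ y # l')"
      unfolding ad_form_append linear_add[OF linear_ad_form, symmetric]
      by (simp add: ad_form_def br_add_left)
  next
    fix l l' c x
    have "ad_form w (sc c x # l') = sc c (ad_form w (x # l'))"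
      by (simp add: ad_form_def br_sc_left)
    then show "ad_form w (l @ sc c x # l') = sc c (ad_form w (l @ x # l'))"
      by (simp add: ad_form_append ad_form_sc)
  next
    fix l l' a b
    show "ad_form w (l @ a # b # l') - ad_form w (l @ b # a # l') = ad_form w (l @ br a b # l')"
      unfolding ad_form_append linear_diff[OF linear_ad_form, symmetric]
      by (simp add: ad_form_def jacobi_derivation[of a b])
  next
    fix l :: "'g list" assume l: "\<And>x. x \<in> set l \<Longrightarrow> norm x \<le> 1"
    show "norm (ad_form w l) \<le> K ^ N * norm w"
    proof (cases "N < length l")
      case False
      then have "K ^ length l * norm w \<le> K ^ N * norm w"
        using K by (intro mult_right_mono power_increasing) auto
      with bound[OF l] show ?thesis by (rule order_trans)
    qed (use van K in simp)
  qed (rule van)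
qed

abbreviation Exp_ad :: "'g \<Rightarrow> 'g \<Rightarrow> 'g" where
  "Exp_ad z \<equiv> nil_eval N (fps_exp 1) (br z)"

lemma exp_act_ad_form: "exp_act z (ad_form w) l = ad_form (Exp_ad z w) l"
  by (simp add: exp_act_def ad_form_append ad_form_replicate nil_eval_def inverse_eq_divide
      linear_sum[OF linear_ad_form] linear_scale[OF linear_ad_form])

lemma Exp_ad_flow: "Exp_ad (flow y t x) w = Exp_ad x (Exp_ad (t *\<^sub>R y) w)"
proof -
  have 1: "exp_act (t *\<^sub>R y) (ad_form w) = ad_form (Exp_ad (t *\<^sub>R y) w)"
    by (rule ext) (rule exp_act_ad_form)
  have "ad_form (Exp_ad (flow y t x) w) [] = ad_form (Exp_ad x (Exp_ad (t *\<^sub>R y) w)) []"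
    using exp_act_flow[OF word_form_ad_form, of y t x w "[]"] unfolding 1 exp_act_ad_form by simp
  then show ?thesis by (simp add: ad_form_def)
qed

lemma inv_field_Exp_ad:
  "inv_field y z = (\<Sum>k\<le>N. ((- 1) ^ k / real (k + 1)) *\<^sub>R ((\<lambda>w. Exp_ad z w - w) ^^ k) (Exp_ad z y))"
proof -
  have 1: "nil_eval N 1 (br z) w = w" for w
    by (rule nil_eval_eq_one) simp
  have "nil_eval N (fps_exp 1 - 1) (br z) = (\<lambda>w. Exp_ad z w - w)"
    by (rule ext) (simp add: nil_eval_diff 1)
  then show ?thesis
    by (simp only: inv_field_def dlog_fps_def nil_eval_sum nil_eval_cmult
        nil_eval_power[OF linear_br ad_vanish[OF less_imp_le]])
qed

text \<open>
  The exponents \<open>(p, q)\<close> and the coefficients that occur when \<open>exp (ad x) exp (t ad y) - 1\<close> is expanded.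
\<close>

definition word_pairs :: "(nat \<times> nat) set" where
  "word_pairs = {..N} \<times> {..N} - {(0, 0)}"

definition pair_weight :: "real \<Rightarrow> nat \<times> nat \<Rightarrow> real" where
  "pair_weight t = (\<lambda>(p, q). t ^ q / (fact p * fact q))"

lemma finite_word_pairs: "finite word_pairs"
  by (simp add: word_pairs_def)

lemma Exp_ad_minus_id:
  "Exp_ad (flow y t x) w - w =
    (\<Sum>(p, q)\<in>word_pairs. pair_weight t (p, q) *\<^sub>R (br x ^^ p) ((br y ^^ q) w))"
proof -
  have "(br (t *\<^sub>R y) ^^ n) w = t ^ n *\<^sub>R (br y ^^ n) w" for n
    by (induction n) (simp_all add: br_scaleR_left br_scaleR_right)
  then have "Exp_ad (flow y t x) w =
      (\<Sum>p\<le>N. \<Sum>q\<le>N. pair_weight t (p, q) *\<^sub>R (br x ^^ p) ((br y ^^ q) w))"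
    unfolding Exp_ad_flow
    by (simp add: nil_eval_def pair_weight_def ad_sum ad_scaleR scaleR_sum_right field_simps)
  also have "\<dots> = (\<Sum>(p, q)\<in>insert (0, 0) word_pairs.
      pair_weight t (p, q) *\<^sub>R (br x ^^ p) ((br y ^^ q) w))"
    unfolding sum.cartesian_product by (intro sum.cong) (auto simp: word_pairs_def)
  also have "\<dots> = w + (\<Sum>(p, q)\<in>word_pairs. pair_weight t (p, q) *\<^sub>R (br x ^^ p) ((br y ^^ q) w))"
    by (subst sum.insert) (auto simp: finite_word_pairs pair_weight_def, simp add: word_pairs_def)
  finally show ?thesis by simp
qed

lemma bch_word_simps:
  "bch_word br x y [] m = (br x ^^ m) y"
  "bch_word br x y ((p, q) # pq) m = (br x ^^ p) ((br y ^^ q) (bch_word br x y pq m))"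
  by (simp_all add: bch_word_def)

text \<open>
  The index lists of the \<open>k\<close>-th power of this expansion.
\<close>

definition word_lists :: "nat \<Rightarrow> (nat \<times> nat) list set" where
  "word_lists k = {pq. set pq \<subseteq> word_pairs \<and> length pq = k}"

lemma finite_word_lists: "finite (word_lists k)"
  unfolding word_lists_def by (rule finite_lists_length_eq[OF finite_word_pairs])

lemma word_lists_Suc:
  "word_lists (Suc k) = (\<lambda>(a, pq). a # pq) ` (word_pairs \<times> word_lists k)"
  by (auto simp: word_lists_def length_Suc_conv image_iff)

lemma Exp_ad_power:
  "((\<lambda>w. Exp_ad (flow y t x) w - w) ^^ k) (Exp_ad (flow y t x) y) =
    (\<Sum>pq\<in>word_lists k. \<Sum>m\<le>N. (prod_list (map (pair_weight t) pq) / fact m) *\<^sub>R bch_word br x y pq m)"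
proof (induction k)
  case 0
  have "Exp_ad (t *\<^sub>R y) y = y"
  proof -
    have "(br (t *\<^sub>R y) ^^ Suc n) y = 0" for n
      by (simp add: funpow_swap1 br_scaleR_left alternating)
    then show ?thesis by (simp add: nil_eval_def sum.atMost_shift del: funpow.simps)
  qed
  moreover have "word_lists 0 = {[]}" by (auto simp: word_lists_def)
  ultimately show ?case
    by (simp add: Exp_ad_flow) (simp add: nil_eval_def bch_word_simps inverse_eq_divide)
next
  case (Suc k)
  let ?c = "\<lambda>pq m. prod_list (map (pair_weight t) pq) / fact m"
  have "((\<lambda>w. Exp_ad (flow y t x) w - w) ^^ Suc k) (Exp_ad (flow y t x) y) =
      (\<Sum>a\<in>word_pairs. \<Sum>pq\<in>word_lists k. \<Sum>m\<le>N.
        ?c (a # pq) m *\<^sub>R bch_word br x y (a # pq) m)"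
    unfolding funpow.simps o_apply Suc unfolding Exp_ad_minus_id
    by (intro sum.cong refl)
      (auto simp: ad_sum ad_scaleR scaleR_sum_right bch_word_simps)
  also have "\<dots> = (\<Sum>(a, pq)\<in>word_pairs \<times> word_lists k. \<Sum>m\<le>N.
        ?c (a # pq) m *\<^sub>R bch_word br x y (a # pq) m)"
    by (rule sum.cartesian_product)
  also have "\<dots> = (\<Sum>pq\<in>word_lists (Suc k). \<Sum>m\<le>N. ?c pq m *\<^sub>R bch_word br x y pq m)"
    unfolding word_lists_Suc
    by (subst sum.reindex) (auto simp: inj_on_def intro!: sum.cong)
  finally show ?case .
qed

lemma bch_word_in_lcs:
  "bch_word br x y pq m \<in> lcs sc br ((\<Sum>(p, q)\<leftarrow>pq. p + q) + m + 1)"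
proof (induction pq)
  case Nil
  show ?case using ad_in_lcs[of y 1 m x] by (simp add: bch_word_simps)
next
  case (Cons a pq)
  obtain p q where a: "a = (p, q)" by (cases a)
  have "(br x ^^ p) ((br y ^^ q) (bch_word br x y pq m)) \<in> lcs sc br (p + (q + ((\<Sum>(p, q)\<leftarrow>pq. p + q) + m + 1)))"
    by (intro ad_in_lcs Cons)
  then show ?case by (simp add: a bch_word_simps add_ac)
qed

text \<open>
  A larger index set than \<open>bch_index N\<close>, of product form; the additional words are zero.
\<close>

definition dynkin_index :: "((nat \<times> nat) list \<times> nat) set" where
  "dynkin_index = (SIGMA pq:(\<Union>k\<le>N. word_lists k). {..N})"

lemma finite_dynkin_index: "finite dynkin_index"
  by (auto simp: dynkin_index_def finite_word_lists)

lemma bch_index_subset: "bch_index N \<subseteq> dynkin_index"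
proof
  fix a assume "a \<in> bch_index N"
  then obtain pq m where a: "a = (pq, m)" and pos: "\<forall>(p, q)\<in>set pq. p + q > 0"
    and less: "(\<Sum>(p, q)\<leftarrow>pq. p + q) + m < N" by (auto simp: bch_index_def)
  have "length pq \<le> (\<Sum>(p, q)\<leftarrow>pq. p + q) \<and> (\<forall>(p, q)\<in>set pq. p + q \<le> (\<Sum>(p, q)\<leftarrow>pq. p + q))"
    using pos by (induction pq) fastforce+
  then show "a \<in> dynkin_index"
    using less pos by (fastforce simp: a dynkin_index_def word_lists_def word_pairs_def)
qed

lemma bch_eq: "bch N br x y = x + (\<Sum>(pq, m)\<in>dynkin_index. bch_coeff pq m *\<^sub>R bch_word br x y pq m)"
proof -
  have "bch_word br x y pq m = 0" if "(pq, m) \<in> dynkin_index - bch_index N" for pq m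
  proof -
    have "\<forall>(p, q)\<in>set pq. p + q > 0"
      using that by (fastforce simp: dynkin_index_def word_lists_def word_pairs_def)
    then have "N \<le> (\<Sum>(p, q)\<leftarrow>pq. p + q) + m" using that by (auto simp: bch_index_def)
    then show ?thesis by (intro lcs_eq_0[OF bch_word_in_lcs]) simp
  qed
  then show ?thesis
    unfolding bch_def
    by (intro arg_cong2[of _ _ _ _ "(+)"] refl sum.mono_neutral_left bch_index_subset finite_dynkin_index)
      auto
qed

lemma bch_coeff_weight:
  "real ((\<Sum>(p, q)\<leftarrow>pq. q) + 1) * t ^ (\<Sum>(p, q)\<leftarrow>pq. q) * bch_coeff pq m =
    (- 1) ^ length pq / real (length pq + 1) * (prod_list (map (pair_weight t) pq) / fact m)"
proof -
  have "prod_list (map (pair_weight t) pq) =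
      t ^ (\<Sum>(p, q)\<leftarrow>pq. q) / (\<Prod>(p, q)\<leftarrow>pq. fact p * fact q)"
    by (induction pq) (auto simp: pair_weight_def power_add)
  then show ?thesis by (simp add: bch_coeff_def del: of_nat_add of_nat_Suc)
qed

text \<open>
  \<open>Z\<close> is Dynkin's series for \<open>x\<close> and \<open>t y\<close>. By \<open>inv_field_Exp_ad\<close> and \<open>Exp_ad_power\<close> it has the same
  derivative as the flow, and \<open>Z 0 = x\<close>.
\<close>

lemma flow_eq_bch: "flow y 1 x = bch N br x y"
proof -
  define e where "e pq = (\<Sum>(p, q)\<leftarrow>pq. q)" for pq :: "(nat \<times> nat) list"
  define Z where "Z t = x + (\<Sum>(pq, m)\<in>dynkin_index. (t ^ (e pq + 1) * bch_coeff pq m) *\<^sub>R bch_word br x y pq m)" for t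
  have "(Z has_vector_derivative inv_field y (flow y t x)) (at t)" for t
  proof -
    have "(Z has_vector_derivative (\<Sum>(pq, m)\<in>dynkin_index.
        (real (e pq + 1) * t ^ e pq * bch_coeff pq m) *\<^sub>R bch_word br x y pq m)) (at t)"
    proof -
      have "((\<lambda>t. x + (\<Sum>a\<in>dynkin_index. (t ^ (e (fst a) + 1) * bch_coeff (fst a) (snd a)) *\<^sub>R v a))
          has_vector_derivative (0 + (\<Sum>a\<in>dynkin_index.
            (real (e (fst a) + 1) * t ^ e (fst a) * bch_coeff (fst a) (snd a)) *\<^sub>R v a))) (at t)" for v
      proof (intro has_vector_derivative_add has_vector_derivative_const has_vector_derivative_sum)
        fix a
        have "((\<lambda>t. t ^ (e (fst a) + 1) * bch_coeff (fst a) (snd a)) has_real_derivative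
            real (e (fst a) + 1) * t ^ e (fst a) * bch_coeff (fst a) (snd a)) (at t)"
          using DERIV_cmult_right[OF DERIV_pow[of "e (fst a) + 1" t]] by simp
        from has_vector_derivative_scaleR[OF this has_vector_derivative_const[of "v a"]]
        show "((\<lambda>t. (t ^ (e (fst a) + 1) * bch_coeff (fst a) (snd a)) *\<^sub>R v a) has_vector_derivative
            (real (e (fst a) + 1) * t ^ e (fst a) * bch_coeff (fst a) (snd a)) *\<^sub>R v a) (at t)"
          by simp
      qed
      then show ?thesis unfolding Z_def case_prod_unfold by simp
    qed
    also have "(\<Sum>(pq, m)\<in>dynkin_index.
        (real (e pq + 1) * t ^ e pq * bch_coeff pq m) *\<^sub>R bch_word br x y pq m) =
        (\<Sum>pq\<in>(\<Union>k\<le>N. word_lists k). \<Sum>m\<le>N.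
          ((- 1) ^ length pq / real (length pq + 1)) *\<^sub>R
            (prod_list (map (pair_weight t) pq) / fact m) *\<^sub>R bch_word br x y pq m)"
      unfolding dynkin_index_def e_def bch_coeff_weight scaleR_scaleR
      by (rule sum.Sigma[symmetric]) (auto simp: finite_word_lists)
    also have "\<dots> = (\<Sum>k\<le>N. \<Sum>pq\<in>word_lists k. \<Sum>m\<le>N.
          ((- 1) ^ length pq / real (length pq + 1)) *\<^sub>R
            (prod_list (map (pair_weight t) pq) / fact m) *\<^sub>R bch_word br x y pq m)"
      by (rule sum.UNION_disjoint) (auto simp: finite_word_lists, auto simp: word_lists_def)
    also have "\<dots> = (\<Sum>k\<le>N. ((- 1) ^ k / real (k + 1)) *\<^sub>R
        (\<Sum>pq\<in>word_lists k. \<Sum>m\<le>N. (prod_list (map (pair_weight t) pq) / fact m) *\<^sub>R bch_word br x y pq m))"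
      unfolding scaleR_sum_right by (intro sum.cong refl) (simp add: word_lists_def)
    also have "\<dots> = inv_field y (flow y t x)"
      unfolding inv_field_Exp_ad Exp_ad_power ..
    finally show ?thesis .
  qed
  then have "((\<lambda>t. flow y t x - Z t) has_vector_derivative 0) (at t)" for t
    using has_vector_derivative_diff[OF flow_derivative[of y x t]] by fastforce
  then have "flow y 1 x - Z 1 = flow y 0 x - Z 0"
    by (intro has_derivative_zero_unique[of UNIV]) (auto simp: has_vector_derivative_def)
  also have "\<dots> = 0" by (simp add: flow_0 Z_def case_prod_unfold)
  finally show ?thesis by (simp add: Z_def bch_eq)
qed

lemma bch_commuting:
  assumes "br x y = 0" "0 < N" shows "bch N br x y = x + y"
proof -
  have ad: "(br x ^^ n) y = (if n = 0 then y else 0)" "(br y ^^ n) y = (if n = 0 then y else 0)" for n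
    using assms(1) alternating[of y] by (cases n; simp add: funpow_swap1)+
  have "bch_word br x y pq m = (if (\<forall>a\<in>set pq. a = (0, 0)) \<and> m = 0 then y else 0)" for pq m
  proof (induction pq)
    case (Cons a pq)
    then show ?case
      by (cases a; cases "(\<forall>a\<in>set pq. a = (0, 0)) \<and> m = 0") (auto simp: bch_word_simps ad)
  qed (simp add: bch_word_simps ad)
  moreover have "(\<forall>a\<in>set pq. a = (0, 0)) \<and> m = 0 \<longleftrightarrow> (pq, m) = ([], 0)" if "(pq, m) \<in> bch_index N" for pq m
    using that by (cases pq) (auto simp: bch_index_def)
  ultimately have "bch N br x y = x + (\<Sum>a\<in>bch_index N. if a = ([], 0) then y else 0)"
    unfolding bch_def
    by (intro arg_cong2[of _ _ _ _ "(+)"] refl sum.cong)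
      (auto simp: bch_coeff_def split: if_splits)
  moreover have "([], 0) \<in> bch_index N" using assms(2) by (simp add: bch_index_def)
  moreover have "finite (bch_index N)"
    using bch_index_subset finite_dynkin_index by (rule finite_subset)
  ultimately show ?thesis by simp
qed

section \<open>A form extending the identity of the Lie algebra\<close>

text \<open>
  The iterated invariant derivatives of the identity map at the origin. As a linear map on the
  enveloping algebra it restricts to the identity of the Lie algebra.
\<close>

definition chart_form :: "'g list \<Rightarrow> 'g" where
  "chart_form l = iter_deriv l (\<lambda>y. y) 0"

lemma word_form_chart_form: "word_form N chart_form"
proof -
  obtain K where K: "\<And>w m c f y. lie_poly w m c f \<Longrightarrow> norm y \<le> 1 \<Longrightarrow> norm (f y) \<le> c * K ^ m"
    using lie_poly_bounded by blast
  have bound: "\<exists>m c. \<forall>l. length l = n \<longrightarrow> (\<forall>x\<in>set l. norm x \<le> 1) \<longrightarrow> lie_poly 0 m c (iter_deriv l (\<lambda>y. y))" for n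
  proof (induction n)
    case 0
    show ?case using lie_poly.ident by auto
  next
    case (Suc n)
    then obtain m c where IH: "\<And>l. length l = n \<Longrightarrow> (\<forall>x\<in>set l. norm x \<le> 1) \<Longrightarrow> lie_poly 0 m c (iter_deriv l (\<lambda>y. y))"
      by blast
    have "lie_poly 0 (m + N) (real m * c * inv_field_bound) (iter_deriv (a # l) (\<lambda>y. y))"
      if "length l = n" "\<forall>x\<in>set (a # l). norm x \<le> 1" for a l
    proof -
      have l: "lie_poly 0 m c (iter_deriv l (\<lambda>y. y))" using that by (intro IH) auto
      have "real m * c * (inv_field_bound * norm a) \<le> real m * c * inv_field_bound"
        using that lie_poly_nonneg[OF l]
        by (intro mult_left_mono mult_left_le) (auto simp: inv_field_bound_def intro: sum_nonneg)
      then show ?thesis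
        using lie_poly_field_deriv[OF lie_poly_inv_field[of a] l] by (auto intro: lie_poly.weaken)
    qed
    then show ?case by (intro exI[of _ "m + N"] exI[of _ "real m * c * inv_field_bound"]) (auto simp: length_Suc_conv)
  qed
  then obtain m c where mc: "\<And>l. (\<forall>x\<in>set l. norm x \<le> 1) \<Longrightarrow>
      lie_poly 0 (m (length l)) (c (length l)) (iter_deriv l (\<lambda>y. y))"
    by metis
  have p: "lie_polynomial (field_deriv (inv_field a) h)" if "lie_polynomial h" for a h
    using lie_polynomial_iter_deriv[OF that, of "[a]"] by simp
  note P = lie_polynomial_iter_deriv[OF lie_polynomial_ident]
  show ?thesis
  proof (rule word_formI[where C = "\<Sum>n\<le>N. \<bar>c n * K ^ m n\<bar>"])
    fix l l' x y
    show "chart_form (l @ (x + y) # l') = chart_form (l @ x # l') + chart_form (l @ y # l')"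
      by (simp add: chart_form_def inv_field_add field_deriv_field_add P iter_deriv_add p)
  next
    fix l l' k x
    show "chart_form (l @ sc k x # l') = sc k (chart_form (l @ x # l'))"
      by (simp add: chart_form_def inv_field_sc field_deriv_field_sc P iter_deriv_sc p)
  next
    fix l l' a b
    show "chart_form (l @ a # b # l') - chart_form (l @ b # a # l') = chart_form (l @ br a b # l')"
      unfolding chart_form_def by (rule iter_deriv_bracket[OF lie_polynomial_ident])
  next
    fix l :: "'g list" assume "N < length l"
    then show "chart_form l = 0" by (simp add: chart_form_def iter_deriv_vanish[OF lie_polynomial_ident])
  next
    fix l :: "'g list" assume l: "\<And>x. x \<in> set l \<Longrightarrow> norm x \<le> 1"
    show "norm (chart_form l) \<le> (\<Sum>n\<le>N. \<bar>c n * K ^ m n\<bar>)"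
    proof (cases "length l \<le> N")
      case True
      have "norm (chart_form l) \<le> \<bar>c (length l) * K ^ m (length l)\<bar>"
        unfolding chart_form_def using K[OF mc, of l 0] l by fastforce
      also have "\<dots> \<le> (\<Sum>n\<le>N. \<bar>c n * K ^ m n\<bar>)"
        by (rule member_le_sum) (use True in auto)
      finally show ?thesis .
    next
      case False
      then have "chart_form l = 0" by (simp add: chart_form_def iter_deriv_vanish[OF lie_polynomial_ident])
      then show ?thesis by (simp add: sum_nonneg)
    qed
  qed
qed

lemma chart_form_singleton: "chart_form [x] = x"
  using inv_field_dexp[of 0 x] by (simp add: chart_form_def field_deriv_ident dexp_commuting br.zero_left)

text \<open>
  The left side is the Taylor series of the flow of \<open>inv_field x\<close> through the origin, at time 1.
\<close>

lemma exp_act_chart_form: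
  assumes "0 < N" shows "exp_act x chart_form [] = x"
proof -
  have "exp_act x chart_form [] = flow x 1 0"
    by (simp add: exp_act_def chart_form_def flow_def taylor_coeff_def)
  also have "\<dots> = x" by (simp add: flow_eq_bch bch_commuting assms br.zero_left)
  finally show ?thesis .
qed

end

section \<open>The representations\<close>

lemma ex_bij_list:
  assumes "infinite (UNIV :: 'a set)"
  shows "\<exists>code :: 'a list \<Rightarrow> 'a. bij code"
proof -
  have "(UNIV :: 'a set) \<times> (UNIV :: 'a set) \<approx> (UNIV :: 'a set)"
    using card_of_Times_same_infinite[OF assms] by (simp add: eqpoll_iff_card_of_ordIso)
  then obtain p :: "'a \<times> 'a \<Rightarrow> 'a" where p: "inj p"
    unfolding eqpoll_def bij_betw_def by auto
  \<comment> \<open>words are encoded by \<open>z0\<close> and \<open>a # l \<mapsto> s (p (a, code of l))\<close>, where \<open>s\<close> omits the value \<open>z0\<close>\<close>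
  obtain z0 :: 'a where True by blast
  have "UNIV - {z0} \<approx> (UNIV :: 'a set)"
    using assms infinite_insert_eqpoll[of "UNIV - {z0}" z0] by (simp add: insert_absorb eqpoll_sym)
  then have "(UNIV :: 'a set) \<approx> UNIV - {z0}" by (rule eqpoll_sym)
  then obtain s :: "'a \<Rightarrow> 'a" where s: "inj s" "range s = UNIV - {z0}"
    unfolding eqpoll_def bij_betw_def by auto
  define c :: "'a list \<Rightarrow> 'a" where "c = (\<lambda>l. foldr (\<lambda>a z. s (p (a, z))) l z0)"
  have z0: "s a \<noteq> z0" for a using s(2) by blast
  have "l = m" if "c l = c m" for l m
    using that
  proof (induction l arbitrary: m)
    case Nil
    then show ?case using z0[symmetric] by (cases m) (simp_all add: c_def)
  next
    case (Cons a l)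
    show ?case
    proof (cases m)
      case Nil
      then show ?thesis using Cons.prems z0 by (simp add: c_def)
    next
      case (Cons b m')
      then have "p (a, c l) = p (b, c m')"
        using Cons.prems s(1) by (simp add: c_def inj_eq)
      then show ?thesis using Cons.IH[of m'] p Cons by (simp add: inj_eq)
    qed
  qed
  then have "inj c" by (rule injI)
  moreover have "inj (\<lambda>a::'a. [a])" by (rule injI) simp
  ultimately show ?thesis
    using Schroeder_Bernstein[of c UNIV UNIV "\<lambda>a. [a]"] by auto
qed

text \<open>
  \<open>code\<close> encodes words as points, so that functions on words become elements of \<^typ>\<open>'g rep_vec\<close>.
\<close>

locale word_representation = nilpotent_banach_lie_algebra sc br N
  for sc :: "'k::real_normed_field \<Rightarrow> 'g::banach \<Rightarrow> 'g" and br :: "'g \<Rightarrow> 'g \<Rightarrow> 'g" and N :: nat +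
  fixes code :: "'g list \<Rightarrow> 'g"
  assumes bij_code: "bij code" and N_pos: "0 < N"
begin

text \<open>
  \<open>form\<close> and \<open>enc\<close> translate between \<^typ>\<open>'g rep_vec\<close> and functions on words.
\<close>

definition form :: "'g rep_vec \<Rightarrow> 'g list \<Rightarrow> 'g" where
  "form f l = f (code l)"

definition enc :: "('g list \<Rightarrow> 'g) \<Rightarrow> 'g rep_vec" where
  "enc F z = F (inv_into UNIV code z)"

lemma form_enc [simp]: "form (enc F) = F"
  using bij_code by (simp add: form_def enc_def fun_eq_iff bij_is_inj)

lemma enc_form [simp]: "enc (form f) = f"
  using bij_code by (simp add: form_def enc_def fun_eq_iff bij_is_surj surj_f_inv_f)

lemma form_eqI: "(\<And>l. form f l = form g l) \<Longrightarrow> f = g"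
  by (metis enc_form ext)

text \<open>
  The representation space, with the supremum norm over the words in the unit ball.
\<close>

definition scX :: "'k \<Rightarrow> 'g rep_vec \<Rightarrow> 'g rep_vec" where
  "scX c f = (\<lambda>z. sc c (f z))"

definition X :: "'g rep_vec set" where
  "X = {f. word_form N (form f)}"

definition unit_lists :: "'g list set" where
  "unit_lists = {l. \<forall>x\<in>set l. norm x \<le> 1}"

definition nrm :: "'g rep_vec \<Rightarrow> real" where
  "nrm f = (SUP l\<in>unit_lists. norm (form f l))"

lemma form_simps [simp]:
  "form (f + g) l = form f l + form g l" "form (f - g) l = form f l - form g l"
  "form 0 l = 0" "form (scX c f) l = sc c (form f l)"
  by (simp_all add: form_def scX_def)

lemma X_I: "word_form N (form f) \<Longrightarrow> f \<in> X"
  and X_D: "f \<in> X \<Longrightarrow> word_form N (form f)"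
  by (simp_all add: X_def)

lemma
  shows X_zero: "0 \<in> X"
    and X_add: "f \<in> X \<Longrightarrow> g \<in> X \<Longrightarrow> f + g \<in> X"
    and X_sc: "f \<in> X \<Longrightarrow> scX c f \<in> X"
    and X_diff: "f \<in> X \<Longrightarrow> g \<in> X \<Longrightarrow> f - g \<in> X"
proof -
  show "0 \<in> X" using word_form_zero[of N] by (auto intro: X_I simp: form_simps[abs_def])
  show "f + g \<in> X" if "f \<in> X" "g \<in> X"
    using word_form_plus[OF X_D X_D, OF that] by (auto intro: X_I simp: form_simps[abs_def])
  show "scX c f \<in> X" if "f \<in> X" for c f
    using word_form_scale[OF X_D, OF that, of c] by (auto intro: X_I simp: form_simps[abs_def])
  show "f - g \<in> X" if "f \<in> X" "g \<in> X"
    using word_form_plus[OF X_D[OF that(1)] word_form_scaleR_form[OF X_D[OF that(2)], of "-1"]]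
    by (auto intro!: X_I simp: form_simps[abs_def])
qed

lemma Nil_unit: "[] \<in> unit_lists"
  by (simp add: unit_lists_def)

lemma nrm_le: "(\<And>l. l \<in> unit_lists \<Longrightarrow> norm (form f l) \<le> C) \<Longrightarrow> nrm f \<le> C"
  unfolding nrm_def using Nil_unit by (intro cSUP_least) auto

lemma norm_form_le: "f \<in> X \<Longrightarrow> l \<in> unit_lists \<Longrightarrow> norm (form f l) \<le> nrm f"
proof -
  assume f: "f \<in> X" and l: "l \<in> unit_lists"
  obtain C where "\<forall>l. (\<forall>x\<in>set l. norm x \<le> 1) \<longrightarrow> norm (form f l) \<le> C"
    using X_D[OF f] by (auto simp: word_form_def)
  then have "bdd_above ((\<lambda>l. norm (form f l)) ` unit_lists)"
    by (auto simp: unit_lists_def bdd_above_def)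
  then show ?thesis unfolding nrm_def using l by (intro cSUP_upper)
qed

lemma nrm_nonneg: "f \<in> X \<Longrightarrow> 0 \<le> nrm f"
  using norm_form_le[OF _ Nil_unit] norm_ge_zero order_trans by blast

lemma norm_form_prod: "f \<in> X \<Longrightarrow> norm (form f l) \<le> nrm f * prod_list (map norm l)"
  by (rule word_form_bound[OF X_D]) (auto intro: norm_form_le simp: unit_lists_def)

lemma prod_unit_list: "l \<in> unit_lists \<Longrightarrow> prod_list (map norm l) \<le> 1"
  by (induction l) (auto simp: unit_lists_def intro!: mult_le_one prod_list_nonneg)

lemma norm_form_append:
  assumes "f \<in> X" "l \<in> unit_lists"
  shows "norm (form f (l @ m)) \<le> nrm f * prod_list (map norm m)"
proof -
  have "prod_list (map norm l) * prod_list (map norm m) \<le> 1 * prod_list (map norm m)"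
    by (intro mult_right_mono prod_unit_list[OF assms(2)] prod_list_nonneg) auto
  then show ?thesis
    using order_trans[OF norm_form_prod[OF assms(1), of "l @ m"]] mult_left_mono[OF _ nrm_nonneg[OF assms(1)]]
    by simp
qed

lemma vector_space_scX: "vector_space scX"
proof -
  interpret V: vector_space sc by (rule vector_space_sc)
  show ?thesis
    by unfold_locales (auto simp: scX_def fun_eq_iff V.scale_right_distrib V.scale_left_distrib)
qed

lemma nrm_triangle:
  assumes "f \<in> X" "g \<in> X" shows "nrm (f + g) \<le> nrm f + nrm g"
  by (rule nrm_le) (auto intro: norm_triangle_mono norm_form_le assms)

lemma nrm_sc:
  assumes f: "f \<in> X" shows "nrm (scX c f) = norm c * nrm f"
proof -
  have le: "nrm (scX c f) \<le> norm c * nrm f" if "f \<in> X" for c f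
    by (rule nrm_le) (simp add: norm_sc mult_left_mono norm_form_le that)
  show ?thesis
  proof (cases "c = 0")
    case True
    have "nrm (scX 0 f) \<ge> 0" by (rule nrm_nonneg[OF X_sc[OF f]])
    then show ?thesis using le[OF f, of 0] True by simp
  next
    case False
    have "scX (inverse c) (scX c f) = f"
      using False by (simp add: scX_def sc_mult sc_one)
    then have "nrm f \<le> norm (inverse c) * nrm (scX c f)"
      using le[OF X_sc[OF f], of "inverse c" c] by simp
    then have "norm c * nrm f \<le> nrm (scX c f)"
      using False by (simp add: norm_inverse norm_divide field_simps)
    then show ?thesis using le[OF f] by (rule antisym[rotated])
  qed
qed

lemma X_complete:
  assumes s: "range s \<subseteq> X" and Cauchy: "\<forall>e>0. \<exists>M. \<forall>m\<ge>M. \<forall>n\<ge>M. nrm (s m - s n) < e"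
  shows "\<exists>v\<in>X. (\<lambda>n. nrm (s n - v)) \<longlonglongrightarrow> 0"
proof -
  have sX: "s n \<in> X" for n using s by blast
  have diff: "norm (form (s m) l - form (s n) l) \<le> nrm (s m - s n) * prod_list (map norm l)" for m n l
    using norm_form_prod[OF X_diff[OF sX sX], of m n l] by simp
  have "Cauchy (\<lambda>n. form (s n) l)" for l
  proof (rule CauchyI)
    fix e :: real assume e: "e > 0"
    define P where "P = prod_list (map norm l) + 1"
    have P: "0 \<le> prod_list (map norm l)" by (rule prod_list_nonneg) auto
    then have "e / P > 0" using e by (simp add: P_def)
    then obtain M where M: "\<And>m n. m \<ge> M \<Longrightarrow> n \<ge> M \<Longrightarrow> nrm (s m - s n) < e / P"
      using Cauchy by blast
    have "norm (form (s m) l - form (s n) l) < e" if "m \<ge> M" "n \<ge> M" for m n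
    proof -
      have "norm (form (s m) l - form (s n) l) \<le> nrm (s m - s n) * P"
        using diff[of m l n] nrm_nonneg[OF X_diff[OF sX sX], of m n] by (simp add: P_def distrib_left)
      also have "\<dots> < e / P * P"
        using M[OF that] P by (intro mult_strict_right_mono) (auto simp: P_def)
      also have "\<dots> = e" using P by (simp add: P_def)
      finally show ?thesis .
    qed
    then show "\<exists>M. \<forall>m\<ge>M. \<forall>n\<ge>M. norm (form (s m) l - form (s n) l) < e" by blast
  qed
  then have "\<exists>F. \<forall>l. (\<lambda>n. form (s n) l) \<longlonglongrightarrow> F l"
    by (intro choice allI) (auto simp: Cauchy_convergent_iff convergent_def)
  then obtain F where F: "\<And>l. (\<lambda>n. form (s n) l) \<longlonglongrightarrow> F l" by blast
  have close: "\<exists>M. \<forall>m\<ge>M. \<forall>l\<in>unit_lists. norm (form (s m) l - F l) \<le> e" if e: "e > 0" for e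
  proof -
    obtain M where M: "\<And>m n. m \<ge> M \<Longrightarrow> n \<ge> M \<Longrightarrow> nrm (s m - s n) < e"
      using Cauchy e by blast
    have "norm (form (s m) l - F l) \<le> e" if m: "m \<ge> M" and l: "l \<in> unit_lists" for m l
    proof (rule LIMSEQ_le_const2)
      show "(\<lambda>n. norm (form (s m) l - form (s n) l)) \<longlonglongrightarrow> norm (form (s m) l - F l)"
        by (intro tendsto_intros F)
      have "norm (form (s m) l - form (s n) l) \<le> e" if "n \<ge> M" for n
        using norm_form_le[OF X_diff[OF sX sX] l, of m n] M[OF m that] by simp
      then show "\<exists>K. \<forall>n\<ge>K. norm (form (s m) l - form (s n) l) \<le> e" by blast
    qed
    then show ?thesis by blast
  qed
  obtain M where M: "\<And>l. l \<in> unit_lists \<Longrightarrow> norm (form (s M) l - F l) \<le> 1"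
    using close[of 1] by auto
  note W = X_D[OF sX]
  have lim_eq: "a = b" if "u \<longlonglongrightarrow> a" "v \<longlonglongrightarrow> b" "\<And>n. u n = v n" for u v :: "nat \<Rightarrow> 'g" and a b
  proof -
    have "u = v" by (rule ext) (rule that(3))
    then show ?thesis using that(1,2) LIMSEQ_unique by blast
  qed
  have "word_form N F"
  proof (rule word_formI[where C = "nrm (s M) + 1"])
    fix l l' x y
    show "F (l @ (x + y) # l') = F (l @ x # l') + F (l @ y # l')"
      by (rule lim_eq[OF F tendsto_add[OF F F]]) (rule word_form_add[OF W])
  next
    fix l l' c x
    show "F (l @ sc c x # l') = sc c (F (l @ x # l'))"
      by (rule lim_eq[OF F bounded_linear.tendsto[OF bounded_linear_sc F]]) (rule word_form_sc[OF W])
  next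
    fix l l' a b
    show "F (l @ a # b # l') - F (l @ b # a # l') = F (l @ br a b # l')"
      by (rule lim_eq[OF tendsto_diff[OF F F] F]) (rule word_form_br[OF W])
  next
    fix l :: "'g list" assume "N < length l"
    then show "F l = 0"
      by (intro lim_eq[OF F tendsto_const]) (rule word_form_vanish[OF W])
  next
    fix l :: "'g list" assume "\<And>x. x \<in> set l \<Longrightarrow> norm x \<le> 1"
    then have l: "l \<in> unit_lists" by (simp add: unit_lists_def)
    show "norm (F l) \<le> nrm (s M) + 1"
      using norm_form_le[OF sX l, of M] M[OF l] norm_triangle_sub[of "F l" "form (s M) l"]
      by (simp add: norm_minus_commute)
  qed
  then have FX: "enc F \<in> X" by (simp add: X_def)
  have "(\<lambda>n. nrm (s n - enc F)) \<longlonglongrightarrow> 0"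
  proof (rule LIMSEQ_I)
    fix e :: real assume "e > 0"
    then obtain M where M: "\<And>m l. m \<ge> M \<Longrightarrow> l \<in> unit_lists \<Longrightarrow> norm (form (s m) l - F l) \<le> e / 2"
      using close[of "e / 2"] by auto
    have "norm (nrm (s m - enc F) - 0) < e" if "m \<ge> M" for m
      using nrm_le[of "s m - enc F" "e / 2"] M[OF that] nrm_nonneg[OF X_diff[OF sX FX]] \<open>e > 0\<close>
      by (smt (verit) field_sum_of_halves form_enc form_simps(2) real_norm_def)
    then show "\<exists>M. \<forall>m\<ge>M. norm (nrm (s m - enc F) - 0) < e" by blast
  qed
  with FX show ?thesis by blast
qed

lemma banach_X: "banach_space_on scX X nrm"
proof -
  interpret S: vector_space scX by (rule vector_space_scX)
  have "f = 0" if "f \<in> X" "nrm f = 0" for f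
    by (rule form_eqI) (use norm_form_prod[OF that(1)] that(2) in simp)
  moreover have "nrm 0 = 0"
    using Nil_unit by (auto simp: nrm_def image_constant_conv)
  moreover have "S.subspace X"
    by (rule S.subspaceI) (auto intro: X_zero X_add X_sc)
  ultimately show ?thesis
    unfolding banach_space_on_def
    using vector_space_scX nrm_triangle nrm_sc X_complete by blast
qed

lemma op_norm_le:
  assumes "\<And>f. f \<in> X \<Longrightarrow> nrm f \<le> 1 \<Longrightarrow> nrm (T f) \<le> C"
  shows "op_norm X nrm T \<le> C"
  unfolding op_norm_def
proof (rule cSup_least)
  have "nrm 0 = 0" using Nil_unit by (auto simp: nrm_def image_constant_conv)
  then show "{nrm (T v) |v. v \<in> X \<and> nrm v \<le> 1} \<noteq> {}" using X_zero by fastforce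
qed (use assms in blast)

lemma op_norm_nonneg:
  assumes "\<And>f. f \<in> X \<Longrightarrow> nrm f \<le> 1 \<Longrightarrow> nrm (T f) \<le> C" and "\<And>f. f \<in> X \<Longrightarrow> T f \<in> X"
  shows "0 \<le> op_norm X nrm T"
proof -
  have "nrm 0 = 0" using Nil_unit by (auto simp: nrm_def image_constant_conv)
  then have "nrm (T 0) \<le> op_norm X nrm T"
    unfolding op_norm_def using X_zero assms(1)
    by (intro cSup_upper) (auto simp: bdd_above_def)
  then show ?thesis using nrm_nonneg[OF assms(2)[OF X_zero]] by linarith
qed

subsection \<open>The Lie algebra representation\<close>

text \<open>
  The operator that appends the letter \<open>x\<close>, extensional outside \<open>X\<close>.
\<close>

definition rho :: "'g \<Rightarrow> 'g rep_vec \<Rightarrow> 'g rep_vec" where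
  "rho x = restrict (\<lambda>f. enc (\<lambda>l. form f (l @ [x]))) X"

lemma form_rho: "f \<in> X \<Longrightarrow> form (rho x f) l = form f (l @ [x])"
  by (simp add: rho_def)

lemma rho_in_X: "f \<in> X \<Longrightarrow> rho x f \<in> X"
  using word_form_mono[OF word_form_append[OF X_D, of f "[x]"], of N] by (simp add: X_def rho_def)

lemma nrm_rho_le: "f \<in> X \<Longrightarrow> nrm (rho x f) \<le> norm x * nrm f"
  by (rule nrm_le) (use norm_form_append[of f _ "[x]"] in \<open>simp add: form_rho mult.commute\<close>)

lemma rho_bounded_op: "rho x \<in> bounded_ops scX X nrm"
proof -
  have "rho x \<in> X \<rightarrow>\<^sub>E X" using rho_in_X by (auto simp: rho_def)
  moreover have "rho x (f + g) = rho x f + rho x g" if "f \<in> X" "g \<in> X" for f g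
    by (rule form_eqI) (simp add: form_rho that X_add)
  moreover have "rho x (scX c f) = scX c (rho x f)" if "f \<in> X" for c f
    by (rule form_eqI) (simp add: form_rho that X_sc)
  moreover have "\<exists>C. \<forall>f\<in>X. nrm (rho x f) \<le> C * nrm f"
    using nrm_rho_le by blast
  ultimately show ?thesis by (simp add: bounded_ops_def)
qed

lemma rho_lie_rep: "bounded_lie_rep sc br scX X nrm rho"
  unfolding bounded_lie_rep_def
proof (intro conjI allI ballI)
  show "range rho \<subseteq> bounded_ops scX X nrm" using rho_bounded_op by blast
  show "\<exists>C. \<forall>x. op_norm X nrm (rho x) \<le> C * norm x"
  proof (intro exI[of _ 1] allI op_norm_le)
    fix x f assume "f \<in> X" "nrm f \<le> 1"
    then show "nrm (rho x f) \<le> 1 * norm x"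
      using nrm_rho_le[of f x] mult_left_mono[of "nrm f" 1 "norm x"] by simp
  qed
next
  fix x y f assume f: "f \<in> X"
  note W = X_D[OF f]
  show "rho (x + y) f = rho x f + rho y f"
    by (rule form_eqI) (use word_form_add[OF W, of _ x y "[]"] in \<open>simp add: form_rho f\<close>)
  show "rho (sc c x) f = scX c (rho x f)" for c
    by (rule form_eqI) (use word_form_sc[OF W, of _ c x "[]"] in \<open>simp add: form_rho f\<close>)
  show "rho (br x y) f = rho x (rho y f) - rho y (rho x f)"
    by (rule form_eqI)
      (use word_form_br[OF W, of _ x y "[]", symmetric] in \<open>simp add: form_rho f rho_in_X\<close>)
qed

lemma inj_rho: "inj rho"
proof (rule injI)
  fix x y assume "rho x = rho y"
  then have "form (rho x (enc chart_form)) [] = form (rho y (enc chart_form)) []" by simp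
  then show "x = y"
    by (simp add: form_rho X_def word_form_chart_form chart_form_singleton)
qed

text \<open>
  If \<open>T\<close> lowers the length of the longest word on which a form can be nonzero, then its
  \<open>(N + 1)\<close>-st power is zero.
\<close>

lemma nilpotent_iteration:
  assumes T: "\<And>f. f \<in> X \<Longrightarrow> T f \<in> X"
    and lower: "\<And>f l. f \<in> X \<Longrightarrow> (\<And>m. length l < length m \<Longrightarrow> form f m = 0) \<Longrightarrow> form (T f) l = 0"
    and f: "f \<in> X" and q: "N < q"
  shows "(T ^^ q) f = 0"
proof -
  have "(T ^^ j) f \<in> X \<and> (\<forall>l. N < length l + j \<longrightarrow> form ((T ^^ j) f) l = 0)" for j
  proof (induction j)
    case 0
    show ?case using f word_form_vanish[OF X_D[OF f]] by simp
  next
    case (Suc j)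
    then show ?case by (auto intro!: T lower)
  qed
  from this[of q] show ?thesis by (intro form_eqI) (use q in simp)
qed

lemma rho_nilpotent: "N < q \<Longrightarrow> nilpotent_rep X rho q"
  unfolding nilpotent_rep_def
  by (intro allI ballI nilpotent_iteration) (auto simp: rho_in_X form_rho)

subsection \<open>The group representation\<close>

text \<open>
  The exponential of \<open>rho x\<close>, extensional outside \<open>X\<close>.
\<close>

definition pi_rep :: "'g \<Rightarrow> 'g rep_vec \<Rightarrow> 'g rep_vec" where
  "pi_rep x = restrict (\<lambda>f. enc (exp_act x (form f))) X"

lemma form_pi: "f \<in> X \<Longrightarrow> form (pi_rep x f) = exp_act x (form f)"
  by (simp add: pi_rep_def)

lemma pi_in_X: "f \<in> X \<Longrightarrow> pi_rep x f \<in> X"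
  using word_form_exp_act[OF X_D] by (simp add: X_def pi_rep_def)

lemma prod_list_replicate: "prod_list (map norm (replicate n x)) = norm x ^ n"
  by (induction n) simp_all

lemma nrm_pi_le: "f \<in> X \<Longrightarrow> nrm (pi_rep x f) \<le> (\<Sum>n\<le>N. norm x ^ n / fact n) * nrm f"
proof (rule nrm_le)
  fix l assume f: "f \<in> X" and l: "l \<in> unit_lists"
  have "norm (form (pi_rep x f) l) \<le> (\<Sum>n\<le>N. norm ((1 / fact n) *\<^sub>R form f (l @ replicate n x)))"
    unfolding form_pi[OF f] exp_act_def by (rule norm_sum)
  also have "\<dots> \<le> (\<Sum>n\<le>N. norm x ^ n / fact n * nrm f)"
    using norm_form_append[OF f l, of "replicate n x" for n]
    by (intro sum_mono) (simp add: prod_list_replicate divide_right_mono mult.commute)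
  finally show "norm (form (pi_rep x f) l) \<le> (\<Sum>n\<le>N. norm x ^ n / fact n) * nrm f"
    by (simp add: sum_distrib_right)
qed

lemma pi_bounded_op: "pi_rep x \<in> bounded_ops scX X nrm"
proof -
  have "pi_rep x \<in> X \<rightarrow>\<^sub>E X" using pi_in_X by (auto simp: pi_rep_def)
  moreover have "pi_rep x (f + g) = pi_rep x f + pi_rep x g" if "f \<in> X" "g \<in> X" for f g
    by (rule form_eqI)
      (simp add: form_pi that X_add exp_act_def scaleR_right_distrib sum.distrib)
  moreover have "pi_rep x (scX c f) = scX c (pi_rep x f)" if "f \<in> X" for c f
    by (rule form_eqI) (simp add: form_pi that X_sc exp_act_def sc_sum_right sc_scaleR)
  moreover have "\<exists>C. \<forall>f\<in>X. nrm (pi_rep x f) \<le> C * nrm f"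
    using nrm_pi_le by blast
  ultimately show ?thesis by (simp add: bounded_ops_def)
qed

lemma pi_bch: "pi_rep (bch N br x y) = compose X (pi_rep x) (pi_rep y)"
proof
  fix f
  show "pi_rep (bch N br x y) f = compose X (pi_rep x) (pi_rep y) f"
  proof (cases "f \<in> X")
    case True
    show ?thesis
      by (rule form_eqI)
        (use exp_act_flow[OF X_D[OF True] order_refl, of y 1 x] in
          \<open>simp add: True compose_eq form_pi pi_in_X flow_eq_bch\<close>)
  qed (simp add: pi_rep_def compose_def)
qed

lemma pi_zero: "pi_rep 0 = (\<lambda>v\<in>X. v)"
proof -
  have "exp_act 0 (form f) = form f" if "f \<in> X" for f
    by (rule ext) (rule exp_act_0[OF X_D[OF that]])
  then show ?thesis by (simp add: pi_rep_def cong: restrict_cong)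
qed

lemma pi_hom: "pi_rep \<in> hom (bch_group N br) (units_of (op_monoid scX X nrm))"
proof -
  have "pi_rep x \<in> Units (op_monoid scX X nrm)" for x
  proof -
    have "compose X (pi_rep y) (pi_rep (- y)) = (\<lambda>v\<in>X. v)" for y
      unfolding pi_bch[symmetric] pi_zero[symmetric]
      by (subst bch_commuting) (simp_all add: N_pos br.minus_right alternating)
    from this[of x] this[of "- x"] show ?thesis
      using pi_bounded_op by (auto simp: Units_def op_monoid_def)
  qed
  then show ?thesis
    by (auto simp: hom_def bch_group_def units_of_def op_monoid_def pi_bch)
qed

lemma pi_Lipschitz:
  assumes f: "f \<in> X" and h: "norm (h - g) \<le> 1"
  shows "nrm (pi_rep h f - pi_rep g f)
    \<le> (\<Sum>n\<le>N. real n * (norm g + 1) ^ n / fact n) * norm (h - g) * nrm f"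
proof (rule nrm_le)
  fix l assume l: "l \<in> unit_lists"
  define M where "M = norm g + 1"
  have M: "norm h \<le> M" "norm g \<le> M" "1 \<le> M"
    using h norm_triangle_sub[of h g] by (auto simp: M_def)
  have pow: "norm (form f (l @ replicate n h) - form f (l @ replicate n g)) \<le>
      real n * M ^ n * norm (h - g) * nrm f" for n
  proof -
    have "norm (form f (l @ replicate n h @ []) - form f (l @ replicate n g @ [])) \<le>
        nrm f * prod_list (map norm l) * prod_list (map norm ([] :: 'g list)) * (real n * M ^ n) * norm (h - g)"
      by (rule word_form_power_Lipschitz[OF X_D[OF f] norm_form_prod[OF f] M])
    also have "\<dots> = prod_list (map norm l) * (real n * M ^ n * norm (h - g) * nrm f)" by simp
    also have "\<dots> \<le> 1 * (real n * M ^ n * norm (h - g) * nrm f)"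
      using M(3) by (intro mult_right_mono prod_unit_list[OF l] mult_nonneg_nonneg nrm_nonneg[OF f]) auto
    finally show ?thesis by simp
  qed
  have "norm (form (pi_rep h f - pi_rep g f) l) =
      norm (\<Sum>n\<le>N. (1 / fact n) *\<^sub>R (form f (l @ replicate n h) - form f (l @ replicate n g)))"
    by (simp add: form_pi f exp_act_def sum_subtractf scaleR_diff_right)
  also have "\<dots> \<le> (\<Sum>n\<le>N. (real n * M ^ n * norm (h - g) * nrm f) / fact n)"
    by (rule sum_norm_le) (use pow in \<open>simp add: divide_right_mono\<close>)
  finally show "norm (form (pi_rep h f - pi_rep g f) l)
      \<le> (\<Sum>n\<le>N. real n * (norm g + 1) ^ n / fact n) * norm (h - g) * nrm f"
    by (simp add: M_def sum_distrib_right)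
qed

lemma pi_norm_continuous: "norm_continuous_rep (bch_group N br) scX X nrm pi_rep"
  unfolding norm_continuous_rep_def
proof (intro conjI ballI pi_hom)
  fix g :: 'g
  define K where "K = (\<Sum>n\<le>N. real n * (norm g + 1) ^ n / fact n)"
  have K: "K \<ge> 0" unfolding K_def by (intro sum_nonneg) auto
  have bound: "nrm (pi_rep h f - pi_rep g f) \<le> K * norm (h - g)"
    if "f \<in> X" "nrm f \<le> 1" "norm (h - g) \<le> 1" for f :: "'g rep_vec" and h
    using pi_Lipschitz[OF that(1,3)] mult_left_mono[OF that(2), of "K * norm (h - g)"] K
    by (simp add: K_def)
  have "((\<lambda>h. K * norm (h - g)) \<longlongrightarrow> K * norm (g - g)) (at g)" by (intro tendsto_intros)
  then have lim: "((\<lambda>h. K * norm (h - g)) \<longlongrightarrow> 0) (at g)" by simp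
  have "((\<lambda>h. op_norm X nrm (\<lambda>v. pi_rep h v - pi_rep g v)) \<longlongrightarrow> 0) (at g)"
  proof (rule Lim_null_comparison[OF _ lim])
    have "\<forall>\<^sub>F h in at g. dist h g < 1" by (auto simp: eventually_at intro: exI[of _ 1])
    then show "\<forall>\<^sub>F h in at g. norm (op_norm X nrm (\<lambda>v. pi_rep h v - pi_rep g v)) \<le> K * norm (h - g)"
    proof eventually_elim
      case (elim h)
      then have h: "norm (h - g) \<le> 1" by (simp add: dist_norm)
      have "0 \<le> op_norm X nrm (\<lambda>v. pi_rep h v - pi_rep g v)"
        by (rule op_norm_nonneg[OF bound]) (auto simp: h X_diff pi_in_X)
      moreover have "op_norm X nrm (\<lambda>v. pi_rep h v - pi_rep g v) \<le> K * norm (h - g)"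
        by (rule op_norm_le[OF bound]) (auto simp: h)
      ultimately show ?case by simp
    qed
  qed
  then show "((\<lambda>h. op_norm X nrm (\<lambda>v. pi_rep h v - pi_rep g v)) \<longlongrightarrow> 0)
      (at g within carrier (bch_group N br))"
    by (simp add: bch_group_def)
qed

lemma inj_pi: "inj pi_rep"
proof (rule injI)
  fix x y assume "pi_rep x = pi_rep y"
  then have "form (pi_rep x (enc chart_form)) [] = form (pi_rep y (enc chart_form)) []" by simp
  then show "x = y"
    by (simp add: form_pi X_def word_form_chart_form exp_act_chart_form N_pos)
qed

lemma pi_unipotent: "N < q \<Longrightarrow> unipotent_rep (bch_group N br) X pi_rep q"
  unfolding unipotent_rep_def
proof (intro ballI nilpotent_iteration)
  fix g :: 'g and f :: "'g rep_vec" and l :: "'g list"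
  assume f: "f \<in> X" and van: "\<And>m. length l < length m \<Longrightarrow> form f m = 0"
  show "form (pi_rep g f - f) l = 0"
    by (simp add: form_pi f exp_act_def sum.atMost_shift van)
qed (auto simp: X_diff pi_in_X)

end

lemma infinite_of_step_nilpotent:
  fixes sc :: "'k::real_normed_field \<Rightarrow> 'g::banach \<Rightarrow> 'g"
  assumes "banach_lie_algebra sc br" "step_nilpotent sc br (N + 1)"
  shows "infinite (UNIV :: 'g set)"
proof -
  interpret nilpotent_banach_lie_algebra sc br N
    using assms by (simp add: nilpotent_banach_lie_algebra_def nilpotent_banach_lie_algebra_axioms_def
        step_nilpotent_def)
  obtain x :: 'g where "x \<noteq> 0"
    using assms(2) lcs_zero[of N] by (auto simp: step_nilpotent_def)
  then have "inj (\<lambda>r::real. r *\<^sub>R x)" by (intro injI) simp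
  then show ?thesis
    using infinite_UNIV_char_0[where 'a = real] finite_imageD finite_subset subset_UNIV by metis
qed

lemma faithful_representations:
  fixes sc :: "'k::real_normed_field \<Rightarrow> 'g::banach \<Rightarrow> 'g"
  assumes g: "banach_lie_algebra sc br" "step_nilpotent sc br (N + 1)" and N: "N \<ge> 1"
  shows
    "(\<exists>(scX :: 'k \<Rightarrow> 'g rep_vec \<Rightarrow> 'g rep_vec) X nrm \<pi>.
       banach_space_on scX X nrm \<and>
       norm_continuous_rep (bch_group N br) scX X nrm \<pi> \<and> inj \<pi> \<and>
       unipotent_rep (bch_group N br) X \<pi> (2 ^ (N - 1) * N + 1)) \<and>
     (\<exists>(scX :: 'k \<Rightarrow> 'g rep_vec \<Rightarrow> 'g rep_vec) X nrm \<rho>.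
       banach_space_on scX X nrm \<and>
       bounded_lie_rep sc br scX X nrm \<rho> \<and> inj \<rho> \<and>
       nilpotent_rep X \<rho> (2 ^ (N - 1) * N + 1))"
proof -
  obtain code :: "'g list \<Rightarrow> 'g" where "bij code"
    using ex_bij_list infinite_of_step_nilpotent[OF g] by blast
  then interpret word_representation sc br N code
    using g N by (simp add: word_representation_def word_representation_axioms_def
        nilpotent_banach_lie_algebra_def nilpotent_banach_lie_algebra_axioms_def step_nilpotent_def)
  have "1 * N \<le> 2 ^ (N - 1) * N" by (intro mult_right_mono) simp_all
  then have q: "N < 2 ^ (N - 1) * N + 1" by linarith
  show ?thesis
    using banach_X pi_norm_continuous inj_pi pi_unipotent[OF q] rho_lie_rep inj_rho rho_nilpotent[OF q]
    by blast
qed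

theorem corollary2p14:
  fixes N :: nat
  assumes "N \<ge> 1"
  shows
    "(\<forall>(sc :: real \<Rightarrow> 'g::banach \<Rightarrow> 'g) br.
        banach_lie_algebra sc br \<and> step_nilpotent sc br (N + 1) \<longrightarrow>
        (\<exists>(scX :: real \<Rightarrow> 'g rep_vec \<Rightarrow> 'g rep_vec) X nrm \<pi>.
           banach_space_on scX X nrm \<and>
           norm_continuous_rep (bch_group N br) scX X nrm \<pi> \<and> inj \<pi> \<and>
           unipotent_rep (bch_group N br) X \<pi> (2 ^ (N - 1) * N + 1)) \<and>
        (\<exists>(scX :: real \<Rightarrow> 'g rep_vec \<Rightarrow> 'g rep_vec) X nrm \<rho>.
           banach_space_on scX X nrm \<and>
           bounded_lie_rep sc br scX X nrm \<rho> \<and> inj \<rho> \<and>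
           nilpotent_rep X \<rho> (2 ^ (N - 1) * N + 1)))
     \<and>
     (\<forall>(sc :: complex \<Rightarrow> 'h::banach \<Rightarrow> 'h) br.
        banach_lie_algebra sc br \<and> step_nilpotent sc br (N + 1) \<longrightarrow>
        (\<exists>(scX :: complex \<Rightarrow> 'h rep_vec \<Rightarrow> 'h rep_vec) X nrm \<pi>.
           banach_space_on scX X nrm \<and>
           norm_continuous_rep (bch_group N br) scX X nrm \<pi> \<and> inj \<pi> \<and>
           unipotent_rep (bch_group N br) X \<pi> (2 ^ (N - 1) * N + 1)) \<and>
        (\<exists>(scX :: complex \<Rightarrow> 'h rep_vec \<Rightarrow> 'h rep_vec) X nrm \<rho>.
           banach_space_on scX X nrm \<and>
           bounded_lie_rep sc br scX X nrm \<rho> \<and> inj \<rho> \<and>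
           nilpotent_rep X \<rho> (2 ^ (N - 1) * N + 1)))"
  by (rule conjI; intro allI impI; elim conjE; rule faithful_representations[OF _ _ assms]; assumption)

end
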